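(* Let $(\bar x,\bar y)$ be a feasible point of (VP). Assume that the value function $V$ is directionally differentiable at $\bar x$ in any direction and that $(u,v)\in C(\bar x,\bar y)$. Then there exists a nonzero vector $(\lambda,\mu,\nu)\in\mathbb R^{1+p+q}$ such that $\lambda\ge0$, $0\le\mu\perp g(\bar x,\bar y)$, $\mu\perp\nabla g(\bar x,\bar y)(u,v)$, $0\le\nu\perp G(\bar x,\bar y)$, $\nu\perp\nabla G(\bar x,\bar y)(u,v)$ and $$0\in\lambda\,\partial(f-V)(\bar x,\bar y;(u,v))+\nabla g(\bar x,\bar y)^T\mu+\nabla G(\bar x,\bar y)^T\nu.$$ Hence the first order sufficient condition for metric subregularity (FOSCMS) for the constraint system of (VP) fails at any feasible solution of (VP) in any critical direction.
   Context: Let $F,f:\mathbb R^n\times\mathbb R^m\to\mathbb R$, $G:\mathbb R^n\times\mathbb R^m\to\mathbb R^q$, $g:\mathbb R^n\times\mathbb R^m\to\mathbb R^p$ be continuously differentiable and $V(x)=\inf_y\{f(x,y):g(x,y)\le0\}$. (VP) is the problem $\min_{x,y}F(x,y)$ s.t. $f(x,y)-V(x)\le0$, $g(x,y)\le0$, $G(x,y)\le0$. Here $(f-V)(x,y)=f(x,y)-V(x)$. For a map $\psi$, $\psi'(z;d)=\lim_{t\downarrow0}(\psi(z+td)-\psi(z))/t$, and $\psi$ is directionally differentiable at $z$ in direction $d$ if this limit exists. With $I_g,I_G$ the active index sets of $g,G$ at $(\bar x,\bar y)$ (the indices $i$ with $g_i(\bar x,\bar y)=0$, respectively $G_i(\bar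 x,\bar y)=0$), $(u,v)\in C(\bar x,\bar y)$ (the critical cone of (VP); such $(u,v)$ is called a critical direction) means $\nabla f(\bar x,\bar y)(u,v)\le V'(\bar x;u)$, $\nabla g_i(\bar x,\bar y)(u,v)\le0$ for $i\in I_g$, $\nabla G_i(\bar x,\bar y)(u,v)\le0$ for $i\in I_G$, and $\nabla F(\bar x,\bar y)(u,v)\le0$. Regular subdifferential: $\widehat\partial\psi(\bar z)=\{\xi:\psi(z)\ge\psi(\bar z)+\langle\xi,z-\bar z\rangle+o(\|z-\bar z\|)\}$. Limiting subdifferential in direction $d$: $\partial\psi(\bar z;d)=\{\xi:\exists\, t_k\downarrow0,\ d^k\to d,\ \xi^k\to\xi\text{ with }\psi(\bar z+t_kd^k)\to\psi(\bar z),\ \xi^k\in\widehat\partial\psi(\bar z+t_kd^k)\}$. $\mathbb B$ is the open unit ball. For a direction $d$ and $\epsilon,\delta>0$: $\mathcal V_{\epsilon,\delta}(d):=\{z\in\epsilon\mathbb B : \big\|\,\|d\|z-\|z\|d\,\big\|\le\delta\|z\|\|d\|\}$. A map $\psi$ is directionally Lipschitz continuous at $\bar z$ in direction $d$ if there are $L,\epsilon,\delta>0$ such that $\|\psi(z)-\psi(z')\|\le L\|z-z'\|$ for all $z,z'\in\bar z+\mathcal V_{\epsilon,\delta}(d)$. FOSCMS for a system $\phi(z)\le0$ at a solution $\bar z$ in direction $d$ (defined for $\phi$ directionally Lipschitz continuous and directionally differentiable at $\bar z$ in direction $d$): there is no $\zeta\ne0$ with $0\le\zeta\perp\phi(\bar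 z)$, $\zeta\perp\phi'(\bar z;d)$ and $0\in\partial\langle\zeta,\phi\rangle(\bar z;d)$. For (VP), $\phi(x,y)=(f(x,y)-V(x),g(x,y),G(x,y))$ and $d=(u,v)$.
   Formalization: The formal theorem additionally assumes that the constraint map (f-V, g, G) is directionally Lipschitz continuous at the feasible point in direction (u,v), the requirement under which FOSCMS is defined; without it the multiplier claim is false. *)

theory Defs
  imports "HOL-Analysis.Analysis" "HOL-Library.Landau_Symbols"
begin

text \<open>
  The value function of the lower level problem may take the values \<open>\<plusminus>\<infinity>\<close>, so functions built from
  it are \<^typ>\<open>ereal\<close>-valued. Vectors of \<open>\<real>\<^sup>k\<close> are ordered componentwise, as in the library.
\<close>

definition continuously_differentiable ::
    "('a::real_normed_vector \<Rightarrow> 'b::real_normed_vector) \<Rightarrow> bool" where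
  "continuously_differentiable h \<longleftrightarrow>
     (\<exists>h' :: 'a \<Rightarrow> 'a \<Rightarrow>\<^sub>L 'b. (\<forall>z. (h has_derivative blinfun_apply (h' z)) (at z)) \<and>
        continuous_on UNIV h')"

text \<open>The infimum over the empty set is \<open>\<infinity>\<close>.\<close>

definition value_fun ::
    "('x \<times> 'y \<Rightarrow> real) \<Rightarrow> ('x \<times> 'y \<Rightarrow> real ^ 'p) \<Rightarrow> 'x \<Rightarrow> ereal" where
  "value_fun f g x = (INF y \<in> {y. g (x, y) \<le> 0}. ereal (f (x, y)))"

definition f_minus_V ::
    "('x \<times> 'y \<Rightarrow> real) \<Rightarrow> ('x \<times> 'y \<Rightarrow> real ^ 'p) \<Rightarrow> 'x \<times> 'y \<Rightarrow> ereal" where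
  "f_minus_V f g = (\<lambda>(x, y). ereal (f (x, y)) - value_fun f g x)"

definition VP_feasible ::
    "('x \<times> 'y \<Rightarrow> real) \<Rightarrow> ('x \<times> 'y \<Rightarrow> real ^ 'p) \<Rightarrow> ('x \<times> 'y \<Rightarrow> real ^ 'q) \<Rightarrow> 'x \<times> 'y \<Rightarrow> bool" where
  "VP_feasible f g G z \<longleftrightarrow> f_minus_V f g z \<le> 0 \<and> g z \<le> 0 \<and> G z \<le> 0"

definition VP_map ::
    "('x \<times> 'y \<Rightarrow> real) \<Rightarrow> ('x \<times> 'y \<Rightarrow> real ^ 'p) \<Rightarrow> ('x \<times> 'y \<Rightarrow> real ^ 'q) \<Rightarrow>
     'x \<times> 'y \<Rightarrow> ereal ^ (unit + 'p + 'q)" where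
  "VP_map f g G z = (\<chi> k. case k of
       Inl _ \<Rightarrow> f_minus_V f g z
     | Inr (Inl i) \<Rightarrow> ereal (g z $ i)
     | Inr (Inr j) \<Rightarrow> ereal (G z $ j))"

definition dir_deriv :: "('a::real_normed_vector \<Rightarrow> ereal) \<Rightarrow> 'a \<Rightarrow> 'a \<Rightarrow> ereal" where
  "dir_deriv \<psi> z d = Lim (at_right 0) (\<lambda>t. (\<psi> (z + t *\<^sub>R d) - \<psi> z) / ereal t)"

text \<open>
  The limit has to be finite; together with finiteness at \<open>z\<close> this forces \<open>\<psi> (z + t *\<^sub>R d)\<close>
  to be finite for all small \<open>t > 0\<close>.
\<close>

definition dir_differentiable :: "('a::real_normed_vector \<Rightarrow> ereal) \<Rightarrow> 'a \<Rightarrow> 'a \<Rightarrow> bool" where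
  "dir_differentiable \<psi> z d \<longleftrightarrow> \<bar>\<psi> z\<bar> \<noteq> \<infinity> \<and>
     (\<exists>l::real. ((\<lambda>t. (\<psi> (z + t *\<^sub>R d) - \<psi> z) / ereal t) \<longlongrightarrow> ereal l) (at_right 0))"

definition VP_critical_cone ::
    "('x::real_normed_vector \<times> 'y::real_normed_vector \<Rightarrow> real) \<Rightarrow> ('x \<times> 'y \<Rightarrow> real) \<Rightarrow>
     ('x \<times> 'y \<Rightarrow> real ^ 'p) \<Rightarrow> ('x \<times> 'y \<Rightarrow> real ^ 'q) \<Rightarrow> 'x \<times> 'y \<Rightarrow> ('x \<times> 'y) set" where
  "VP_critical_cone F f g G z = {(u, v).
     ereal (frechet_derivative f (at z) (u, v)) \<le> dir_deriv (value_fun f g) (fst z) u \<and>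
     (\<forall>i. g z $ i = 0 \<longrightarrow> frechet_derivative g (at z) (u, v) $ i \<le> 0) \<and>
     (\<forall>i. G z $ i = 0 \<longrightarrow> frechet_derivative G (at z) (u, v) $ i \<le> 0) \<and>
     frechet_derivative F (at z) (u, v) \<le> 0}"

definition regular_subdiff :: "('a::real_inner \<Rightarrow> ereal) \<Rightarrow> 'a \<Rightarrow> 'a set" where
  "regular_subdiff \<psi> z = {\<xi>. \<bar>\<psi> z\<bar> \<noteq> \<infinity> \<and>
     (\<exists>r :: 'a \<Rightarrow> real. r \<in> o[nhds z](\<lambda>w. norm (w - z)) \<and>
        (\<forall>\<^sub>F w in nhds z. \<psi> w \<ge> \<psi> z + ereal (\<xi> \<bullet> (w - z) + r w)))}"

definition dir_limiting_subdiff :: "('a::real_inner \<Rightarrow> ereal) \<Rightarrow> 'a \<Rightarrow> 'a \<Rightarrow> 'a set" where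
  "dir_limiting_subdiff \<psi> z d = {\<xi>. \<bar>\<psi> z\<bar> \<noteq> \<infinity> \<and>
     (\<exists>(t :: nat \<Rightarrow> real) (dk :: nat \<Rightarrow> 'a) (\<xi>k :: nat \<Rightarrow> 'a).
        (\<forall>k. t k > 0) \<and> t \<longlonglongrightarrow> 0 \<and> dk \<longlonglongrightarrow> d \<and> \<xi>k \<longlonglongrightarrow> \<xi> \<and>
        (\<lambda>k. \<psi> (z + t k *\<^sub>R dk k)) \<longlonglongrightarrow> \<psi> z \<and>
        (\<forall>k. \<xi>k k \<in> regular_subdiff \<psi> (z + t k *\<^sub>R dk k)))}"

definition dir_nbhd :: "real \<Rightarrow> real \<Rightarrow> 'a::real_normed_vector \<Rightarrow> 'a set" where
  "dir_nbhd \<epsilon> \<delta> d =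
     {z \<in> ball 0 \<epsilon>. norm (norm d *\<^sub>R z - norm z *\<^sub>R d) \<le> \<delta> * norm z * norm d}"

definition real_vec :: "ereal ^ 'k \<Rightarrow> real ^ 'k" where
  "real_vec a = (\<chi> i. real_of_ereal (a $ i))"

text \<open>Directional Lipschitz continuity of a map with extended real components includes
  finiteness of the map on the directional neighbourhood.\<close>

definition dir_lipschitz :: "('a::real_normed_vector \<Rightarrow> ereal ^ 'k) \<Rightarrow> 'a \<Rightarrow> 'a \<Rightarrow> bool" where
  "dir_lipschitz \<phi> z d \<longleftrightarrow> (\<exists>L \<epsilon> \<delta>. L > 0 \<and> \<epsilon> > 0 \<and> \<delta> > 0 \<and>
     (\<forall>w \<in> dir_nbhd \<epsilon> \<delta> d. \<forall>i. \<bar>\<phi> (z + w) $ i\<bar> \<noteq> \<infinity>) \<and>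
     (\<forall>w \<in> dir_nbhd \<epsilon> \<delta> d. \<forall>w' \<in> dir_nbhd \<epsilon> \<delta> d.
        norm (real_vec (\<phi> (z + w)) - real_vec (\<phi> (z + w'))) \<le> L * norm (w - w')))"

text \<open>
  The condition is meant only for \<open>\<phi>\<close> that are directionally Lipschitz continuous and
  directionally differentiable at \<open>z\<close> in direction \<open>d\<close>. These requirements delimit where the
  notion applies and are not conjuncts of it, so that its negation asserts that a nonzero
  multiplier \<open>\<zeta>\<close> exists.
\<close>

definition FOSCMS :: "('a::real_inner \<Rightarrow> ereal ^ 'k) \<Rightarrow> 'a \<Rightarrow> 'a \<Rightarrow> bool" where
  "FOSCMS \<phi> z d \<longleftrightarrow> \<not> (\<exists>\<zeta> :: real ^ 'k. \<zeta> \<noteq> 0 \<and> 0 \<le> \<zeta> \<and>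
     \<zeta> \<bullet> real_vec (\<phi> z) = 0 \<and>
     \<zeta> \<bullet> real_vec (\<chi> i. dir_deriv (\<lambda>w. \<phi> w $ i) z d) = 0 \<and>
     0 \<in> dir_limiting_subdiff (\<lambda>w. \<Sum>i\<in>UNIV. ereal (\<zeta> $ i) * \<phi> w $ i) z d)"

end

theory Submission
  imports Defs
begin

text \<open>
  Since \<open>f \<ge> V\<close> wherever \<open>g \<le> 0\<close>, the maximum of \<open>f - V\<close> and the components of \<open>g\<close> and \<open>G\<close> is
  nonnegative near \<open>z\<^sub>0 = (x, y)\<close>, while in a critical direction \<open>d\<close> it is at most \<open>o(t)\<close> at \<open>c = z\<^sub>0 + t d\<close>. Replace it
  by the soft maximum \<open>s ln (exp (\<psi> / s) + (\<Sum>i. exp (h i / s)))\<close> with \<open>\<psi> = f - V\<close>, \<open>s = t\<^sup>2\<close>, and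
  minimise this plus \<open>(\<kappa> / t) |z - c|\<^sup>2\<close> over a ball around \<open>c\<close> of radius proportional to \<open>t\<close>,
  with \<open>\<kappa> \<rightarrow> 0\<close> slowly, so that the minimiser lies within \<open>\<kappa> t\<close> of \<open>c\<close>. The
  minimality inequality, solved for \<open>\<psi>\<close>, exhibits a smooth function that touches \<open>\<psi>\<close> from below at
  the minimiser, so it yields a regular subgradient without any fuzzy sum rule. The soft maximum
  weights are the multipliers; those of constraints that are inactive at \<open>z\<^sub>0\<close> or decrease along \<open>d\<close> are
  at most \<open>exp (- const / t)\<close> and vanish in the limit \<open>t \<rightarrow> 0\<close>, and the subgradients stay bounded by the
  directional Lipschitz constant.
\<close>

section \<open>Regular subgradients: lower supports, smooth perturbations, Lipschitz bounds\<close>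

lemma smooth_lower_support_regular_subdiff:
  fixes \<psi> :: "'a::real_inner \<Rightarrow> ereal"
  assumes "\<psi> z = ereal (k z)" and "\<forall>\<^sub>F w in nhds z. ereal (k w) \<le> \<psi> w"
    and "(k has_derivative (\<lambda>w. \<xi> \<bullet> w)) (at z)"
  shows "\<xi> \<in> regular_subdiff \<psi> z"
proof -
  define r where "r w = k w - k z - \<xi> \<bullet> (w - z)" for w
  have "r \<in> o[nhds z](\<lambda>w. norm (w - z))"
  proof (rule landau_o.smallI)
    fix e :: real assume "e > 0"
    then obtain D where "D > 0" and
      D: "\<And>w. norm (w - z) < D \<Longrightarrow> norm (k w - k z - \<xi> \<bullet> (w - z)) \<le> e * norm (w - z)"
      using assms(3) unfolding has_derivative_at_alt by blast
    have "\<forall>\<^sub>F w in nhds z. dist w z < D"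
      using \<open>D > 0\<close> eventually_nhds_metric by blast
    then show "\<forall>\<^sub>F w in nhds z. norm (r w) \<le> e * norm (norm (w - z))"
      by eventually_elim (use D in \<open>simp add: r_def dist_norm\<close>)
  qed
  moreover have "\<forall>\<^sub>F w in nhds z. \<psi> z + ereal (\<xi> \<bullet> (w - z) + r w) \<le> \<psi> w"
    using assms(2) by eventually_elim (simp add: assms(1) r_def)
  ultimately show ?thesis
    using assms(1) by (auto simp: regular_subdiff_def)
qed

text \<open>The lower estimates for \<open>\<psi>\<close> and \<open>h\<close> simply add, with
  remainder \<open>c * r w + q w\<close>; \<open>0 \<le> c\<close> keeps the direction of the first.
  This inclusion needs no limiting argument and later turns subgradients of \<open>f - V\<close>
  into subgradients of the scalarised constraint map.\<close>

lemma regular_subdiff_scale_add_smooth: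
  fixes \<psi> :: "'a::real_inner \<Rightarrow> ereal"
  assumes "\<xi> \<in> regular_subdiff \<psi> z" and "0 \<le> c"
    and "(h has_derivative (\<lambda>w. \<eta> \<bullet> w)) (at z)"
  shows "c *\<^sub>R \<xi> + \<eta> \<in> regular_subdiff (\<lambda>w. ereal c * \<psi> w + ereal (h w)) z"
proof -
  from assms(1) obtain r where fin: "\<bar>\<psi> z\<bar> \<noteq> \<infinity>"
    and r: "r \<in> o[nhds z](\<lambda>w. norm (w - z))"
    and ge: "\<forall>\<^sub>F w in nhds z. \<psi> z + ereal (\<xi> \<bullet> (w - z) + r w) \<le> \<psi> w"
    by (auto simp: regular_subdiff_def)
  from fin obtain a where a: "\<psi> z = ereal a" by auto
  from smooth_lower_support_regular_subdiff[of "\<lambda>w. ereal (h w)" z h \<eta>] assms(3)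
  obtain q where q: "q \<in> o[nhds z](\<lambda>w. norm (w - z))"
    and qge: "\<forall>\<^sub>F w in nhds z. ereal (h z) + ereal (\<eta> \<bullet> (w - z) + q w) \<le> ereal (h w)"
    by (auto simp: regular_subdiff_def)
  have "(\<lambda>w. c * r w + q w) \<in> o[nhds z](\<lambda>w. norm (w - z))"
    using r q by (intro sum_in_smallo) (cases "c = 0"; simp)
  moreover have "\<forall>\<^sub>F w in nhds z. ereal c * \<psi> z + ereal (h z)
      + ereal ((c *\<^sub>R \<xi> + \<eta>) \<bullet> (w - z) + (c * r w + q w)) \<le> ereal c * \<psi> w + ereal (h w)"
    using ge qge
  proof eventually_elim
    case (elim w)
    have "ereal c * (\<psi> z + ereal (\<xi> \<bullet> (w - z) + r w)) \<le> ereal c * \<psi> w"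
      using elim(1) assms(2) by (intro ereal_mult_left_mono) auto
    from add_mono[OF this elim(2)] show ?case
      by (simp add: a algebra_simps)
  qed
  ultimately show ?thesis
    using a by (auto simp: regular_subdiff_def)
qed

text \<open>Testing the subgradient inequality in the direction \<open>\<xi>\<close> itself bounds
  the square of the norm of \<open>\<xi>\<close> by \<open>L + e\<close> times that norm. The bound
  supplies the compactness needed to extract a limiting subgradient.\<close>

lemma regular_subdiff_norm_le_lipschitz:
  fixes \<psi> :: "'a::real_inner \<Rightarrow> ereal"
  assumes \<xi>: "\<xi> \<in> regular_subdiff \<psi> z" and "\<forall>\<^sub>F w in nhds z. \<psi> w = ereal (p w)"
    and lip: "\<forall>\<^sub>F w in nhds z. \<bar>p w - p z\<bar> \<le> L * norm (w - z)" and "0 \<le> L"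
  shows "norm \<xi> \<le> L"
proof (rule field_le_epsilon)
  fix e :: real assume "e > 0"
  from \<xi> obtain r where r: "r \<in> o[nhds z](\<lambda>w. norm (w - z))"
    and ge: "\<forall>\<^sub>F w in nhds z. \<psi> z + ereal (\<xi> \<bullet> (w - z) + r w) \<le> \<psi> w"
    by (auto simp: regular_subdiff_def)
  have z: "\<psi> z = ereal (p z)" using assms(2) eventually_nhds_x_imp_x by fast
  have "\<forall>\<^sub>F w in nhds z. norm (r w) \<le> e * norm (norm (w - z))"
    using landau_o.smallD[OF r \<open>e > 0\<close>] .
  with ge assms(2) lip have "\<forall>\<^sub>F w in nhds z. \<xi> \<bullet> (w - z) \<le> (L + e) * norm (w - z)"
    by eventually_elim (auto simp: z algebra_simps abs_if split: if_splits)
  then obtain D where "D > 0" and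
    D: "\<And>w. dist w z < D \<Longrightarrow> \<xi> \<bullet> (w - z) \<le> (L + e) * norm (w - z)"
    by (auto simp: eventually_nhds_metric)
  show "norm \<xi> \<le> L + e"
  proof (cases "\<xi> = 0")
    case False
    \<comment> \<open>This choice puts the test point \<open>z + a *\<^sub>R \<xi>\<close> at
      distance \<open>D / 2\<close> from \<open>z\<close>.\<close>
    define a where "a = D / (2 * norm \<xi>)"
    have "a > 0" using \<open>D > 0\<close> False by (simp add: a_def)
    have "dist (z + a *\<^sub>R \<xi>) z < D" using False \<open>D > 0\<close> by (simp add: a_def dist_norm)
    from D[OF this] \<open>a > 0\<close> have "a * (norm \<xi> * norm \<xi>) \<le> a * ((L + e) * norm \<xi>)"
      by (simp add: power2_norm_eq_inner[symmetric] power2_eq_square mult_ac)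
    then have "norm \<xi> * norm \<xi> \<le> (L + e) * norm \<xi>"
      using \<open>a > 0\<close> by (simp only: mult_le_cancel_left_pos)
    with False show ?thesis by simp
  qed (use assms \<open>e > 0\<close> in simp)
qed

section \<open>Directional neighbourhoods and difference quotients\<close>

text \<open>Balls around \<open>t *\<^sub>R d\<close> whose radius is proportional to
  \<open>t\<close> are the domains of the later minimisation; inside them the directional Lipschitz
  estimate is available. For \<open>d = 0\<close> the directional neighbourhood is a full
  ball.\<close>

lemma dir_nbhd_contains_cone:
  fixes d :: "'a::real_normed_vector"
  assumes "\<epsilon> > 0" "\<delta> > 0"
  obtains \<rho> \<tau> where "\<rho> > 0" "\<tau> > 0"
    "\<And>t w. 0 < t \<Longrightarrow> t < \<tau> \<Longrightarrow> norm (w - t *\<^sub>R d) \<le> \<rho> * t \<Longrightarrow> w \<in> dir_nbhd \<epsilon> \<delta> d"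
proof (cases "d = 0")
  case True
  show ?thesis
    by (rule that[of 1 \<epsilon>]) (use True assms in \<open>auto simp: dir_nbhd_def\<close>)
next
  case False
  \<comment> \<open>Solves \<open>2 * \<rho> = \<delta> * (norm d - \<rho>)\<close>: the angular
    deviation of \<open>w\<close> is at most \<open>2 * \<rho> * t * norm d\<close>, while
    \<open>norm w\<close> is at least \<open>t * (norm d - \<rho>)\<close>.\<close>
  define \<rho> where "\<rho> = \<delta> * norm d / (2 + \<delta>)"
  have "\<rho> > 0" using False assms by (simp add: \<rho>_def)
  have "(2 + \<delta>) * \<rho> = \<delta> * norm d" using assms by (simp add: \<rho>_def)
  then have \<rho>: "2 * \<rho> + \<delta> * \<rho> = \<delta> * norm d" by (simp add: algebra_simps)
  show ?thesis
  proof (rule that[of \<rho> "\<epsilon> / (norm d + \<rho>)"])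
    fix t and w :: 'a assume t: "0 < t" "t < \<epsilon> / (norm d + \<rho>)"
      and w: "norm (w - t *\<^sub>R d) \<le> \<rho> * t"
    have n: "\<bar>norm w - t * norm d\<bar> \<le> norm (w - t *\<^sub>R d)"
      using norm_triangle_ineq3[of w "t *\<^sub>R d"] t by simp
    have "t * (norm d + \<rho>) < \<epsilon>"
      using t False \<open>\<rho> > 0\<close> by (simp add: field_simps add_pos_pos)
    with n w have "norm w < \<epsilon>" by (simp add: algebra_simps)
    moreover have "norm (norm d *\<^sub>R w - norm w *\<^sub>R d) \<le> \<delta> * norm w * norm d"
    proof -
      have "norm d *\<^sub>R w - norm w *\<^sub>R d
          = norm d *\<^sub>R (w - t *\<^sub>R d) - (norm w - t * norm d) *\<^sub>R d"
        by (simp add: algebra_simps)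
      also have "norm \<dots> \<le> norm d * norm (w - t *\<^sub>R d) + \<bar>norm w - t * norm d\<bar> * norm d"
        by (rule order_trans[OF norm_triangle_ineq4]) simp
      also have "\<dots> \<le> norm d * (\<rho> * t) + (\<rho> * t) * norm d"
        using n w by (intro add_mono mult_left_mono mult_right_mono) auto
      also have "\<dots> = t * (2 * \<rho>) * norm d" by (simp add: algebra_simps)
      also have "\<dots> = \<delta> * (t * norm d - \<rho> * t) * norm d"
      proof -
        have *: "2 * \<rho> = \<delta> * (norm d - \<rho>)" using \<rho> by (simp add: algebra_simps)
        show ?thesis unfolding * by (simp add: algebra_simps)
      qed
      also have "\<dots> \<le> \<delta> * norm w * norm d"
        using n w assms by (intro mult_right_mono mult_left_mono) auto
      finally show ?thesis .
    qed
    ultimately show "w \<in> dir_nbhd \<epsilon> \<delta> d" by (simp add: dir_nbhd_def)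
  qed (use \<open>\<rho> > 0\<close> assms False in \<open>auto intro!: divide_pos_pos add_pos_pos\<close>)
qed

text \<open>Frechet differentiability controls the error uniformly in the direction, so the
  directions \<open>e k\<close> may vary. The filter is left general to cover both one-sided limits
  along a fixed \<open>d\<close> and sequences.\<close>

lemma has_derivative_tendsto_difference_quotient:
  fixes f :: "'a::real_normed_vector \<Rightarrow> real"
  assumes f: "(f has_derivative f') (at z)"
    and t: "(t \<longlongrightarrow> 0) F" "\<forall>\<^sub>F k in F. t k > 0" and e: "(e \<longlongrightarrow> d) F"
  shows "((\<lambda>k. (f (z + t k *\<^sub>R e k) - f z) / t k) \<longlongrightarrow> f' d) F"
proof -
  have bl: "bounded_linear f'" using f by (rule has_derivative_bounded_linear)
  define q where "q k = (f (z + t k *\<^sub>R e k) - f z) / t k - f' (e k)" for k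
  have ze: "((\<lambda>k. t k *\<^sub>R e k) \<longlongrightarrow> 0) F"
    using tendsto_scaleR[OF t(1) e] by simp
  have "(q \<longlongrightarrow> 0) F"
  proof (rule tendstoI)
    fix \<epsilon> :: real assume "\<epsilon> > 0"
    \<comment> \<open>Eventually \<open>norm (e k) < norm d + 1\<close>, so a relative linearisation
      error \<open>c\<close> yields a quotient error below \<open>\<epsilon>\<close>.\<close>
    define c where "c = \<epsilon> / (norm d + 1)"
    have n: "norm d + 1 > 0" by (rule add_nonneg_pos) auto
    then have "c > 0" using \<open>\<epsilon> > 0\<close> by (simp add: c_def)
    then obtain D where "D > 0" and
      D: "\<And>w. norm (w - z) < D \<Longrightarrow> norm (f w - f z - f' (w - z)) \<le> c * norm (w - z)"
      using f unfolding has_derivative_at_alt by blast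
    have "\<forall>\<^sub>F k in F. norm (t k *\<^sub>R e k) < D"
      using tendstoD[OF ze \<open>D > 0\<close>] by (simp add: dist_norm)
    moreover have "\<forall>\<^sub>F k in F. norm (e k) < norm d + 1"
      using order_tendstoD(2)[OF tendsto_norm[OF e], of "norm d + 1"] by simp
    ultimately show "\<forall>\<^sub>F k in F. dist (q k) 0 < \<epsilon>" using t(2)
    proof eventually_elim
      case (elim k)
      have "q k = (f (z + t k *\<^sub>R e k) - f z - f' (t k *\<^sub>R e k)) / t k"
        using elim(3) bl by (simp add: q_def linear_simps(5) diff_divide_distrib)
      then have "\<bar>q k\<bar> \<le> c * norm (t k *\<^sub>R e k) / t k"
        using D[of "z + t k *\<^sub>R e k"] elim by (simp add: pos_divide_le_eq mult_ac)
      also have "\<dots> = c * norm (e k)" using elim by simp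
      also have "\<dots> < c * (norm d + 1)"
        using elim \<open>c > 0\<close> by simp
      finally show ?case using n by (simp add: c_def)
    qed
  qed
  moreover have "((\<lambda>k. f' (e k)) \<longlongrightarrow> f' d) F"
    using bounded_linear.tendsto[OF bl e] .
  ultimately show ?thesis
    using tendsto_add[of q 0 F "\<lambda>k. f' (e k)" "f' d"] by (simp add: q_def)
qed


section \<open>Approximate multipliers from a penalised soft maximum\<close>

text \<open>This is the stationarity condition at a minimiser of soft maximum plus penalty. The term
  \<open>s * ln (1 + CARD('i))\<close> is the largest excess of the soft maximum over the maximum of
  its \<open>1 + CARD('i)\<close> arguments. \<open>small\<close> keeps the minimiser off the
  boundary, and \<open>nonneg\<close> bounds the objective below and the weights above.\<close>

lemma penalized_soft_max_multipliers:
  fixes \<psi> :: "'a::euclidean_space \<Rightarrow> ereal" and h :: "'i::finite \<Rightarrow> 'a \<Rightarrow> real"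
  assumes pos: "r > 0" "s > 0" "\<beta> > 0"
    and fin: "\<And>z. z \<in> cball c r \<Longrightarrow> \<psi> z = ereal (p z)"
    and cont: "continuous_on (cball c r) p"
    and der: "\<And>i z. (h i has_derivative (\<lambda>w. J i z \<bullet> w)) (at z)"
    and nonneg: "\<And>z. z \<in> cball c r \<Longrightarrow> 0 \<le> p z \<or> (\<exists>i. 0 \<le> h i z)"
    and center: "p c \<le> a" "\<And>i. h i c \<le> a"
    and small: "a + s * ln (1 + CARD('i)) < \<beta> * r\<^sup>2"
  obtains z lam and \<mu> :: "real ^ 'i" and \<xi>
  where "z \<in> ball c r" "\<beta> * (norm (z - c))\<^sup>2 \<le> a + s * ln (1 + CARD('i))"
    "0 \<le> lam" "lam \<le> exp (p z / s)" "\<And>i. 0 \<le> \<mu> $ i" "\<And>i. \<mu> $ i \<le> exp (h i z / s)"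
    "lam + (\<Sum>i\<in>UNIV. \<mu> $ i) = 1" "\<xi> \<in> regular_subdiff \<psi> z"
    "lam *\<^sub>R \<xi> + (\<Sum>i\<in>UNIV. \<mu> $ i *\<^sub>R J i z) + (2 * \<beta>) *\<^sub>R (z - c) = 0"
proof -
  define H where "H w = (\<Sum>i\<in>UNIV. exp (h i w / s))" for w
  define S where "S w = exp (p w / s) + H w" for w
  define \<theta> where "\<theta> w = s * ln (S w) + \<beta> * ((w - c) \<bullet> (w - c))" for w
  have H0: "0 \<le> H w" for w by (simp add: H_def sum_nonneg)
  have S0: "0 < S w" for w using H0[of w] by (simp add: S_def add_pos_nonneg)
  have conth: "continuous_on (cball c r) (h i)" for i
    using der has_derivative_continuous by (blast intro: continuous_at_imp_continuous_on)
  have contS: "continuous_on (cball c r) S"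
    unfolding S_def H_def using pos by (intro continuous_intros cont conth) auto
  have "continuous_on (cball c r) \<theta>"
    unfolding \<theta>_def using S0 by (intro continuous_intros contS) (auto simp: less_imp_neq[symmetric])
  then obtain z where z: "z \<in> cball c r" and min: "\<And>w. w \<in> cball c r \<Longrightarrow> \<theta> z \<le> \<theta> w"
    using continuous_attains_inf[of "cball c r" \<theta>] pos by auto
  \<comment> \<open>Bounds the objective at the centre: the penalty vanishes there and each of the
    \<open>1 + CARD('i)\<close> exponentials is at most \<open>exp (a / s)\<close>.\<close>
  define B where "B = a + s * ln (1 + CARD('i))"
  have "\<theta> c \<le> B"
  proof -
    have "S c \<le> exp (a / s) + (\<Sum>i\<in>(UNIV::'i set). exp (a / s))"
      unfolding S_def H_def using center pos
      by (intro add_mono sum_mono) (auto simp: divide_right_mono)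
    also have "\<dots> = (1 + CARD('i)) * exp (a / s)" by (simp add: algebra_simps)
    finally have "ln (S c) \<le> ln ((1 + CARD('i)) * exp (a / s))"
      using S0 by (intro ln_mono) auto
    also have "\<dots> = ln (1 + CARD('i)) + a / s" by (simp add: ln_mult)
    finally have "s * ln (S c) \<le> s * (ln (1 + CARD('i)) + a / s)"
      using pos by (intro mult_left_mono) auto
    then show ?thesis using pos by (simp add: \<theta>_def B_def algebra_simps)
  qed
  moreover have "\<theta> z \<le> \<theta> c" using min pos by simp
  \<comment> \<open>Some argument of the soft maximum is nonnegative at \<open>z\<close>, so its
    exponential alone is at least 1.\<close>
  moreover have S1: "1 \<le> S z"
    using nonneg[OF z]
  proof
    assume "0 \<le> p z"
    then have "1 \<le> exp (p z / s)" using pos by simp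
    then show ?thesis using H0[of z] unfolding S_def by linarith
  next
    assume "\<exists>i. 0 \<le> h i z"
    then obtain i where "0 \<le> h i z" ..
    then have "1 \<le> exp (h i z / s)" using pos by simp
    also have "\<dots> \<le> H z" unfolding H_def by (rule member_le_sum) auto
    finally show ?thesis by (simp add: S_def add_increasing)
  qed
  then have "0 \<le> s * ln (S z)" using pos by simp
  ultimately have zB: "\<beta> * (norm (z - c))\<^sup>2 \<le> B"
    by (simp add: \<theta>_def power2_norm_eq_inner)
  with small have "\<beta> * (norm (z - c))\<^sup>2 < \<beta> * r\<^sup>2" by (simp add: B_def)
  then have "norm (z - c) < r" using pos by (simp add: power_less_imp_less_base)
  then have zr: "z \<in> ball c r" by (simp add: dist_norm norm_minus_commute)

  \<comment> \<open>Minimality \<open>\<theta> z \<le> \<theta> w\<close>, exponentiated and solved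
    for the term of \<open>\<psi>\<close>, reads \<open>K w \<le> exp (p w / s)\<close>, with
    equality at \<open>z\<close>. Hence \<open>s * ln (K w)\<close> is a smooth lower support of
    \<open>\<psi>\<close> at \<open>z\<close>. \<open>D\<close> is the derivative of
    \<open>K\<close> there.\<close>
  define K where "K w = exp ((\<theta> z - \<beta> * ((w - c) \<bullet> (w - c))) / s) - H w" for w
  define D where "D v = S z * (- (2 * \<beta> * ((z - c) \<bullet> v)) / s)
      - (\<Sum>i\<in>UNIV. exp (h i z / s) * ((J i z \<bullet> v) / s))" for v
  have Kz: "K z = exp (p z / s)"
    using pos S0[of z] by (simp add: K_def \<theta>_def S_def)
  have soft: "((\<lambda>w. (\<theta> z - \<beta> * ((w - c) \<bullet> (w - c))) / s)
      has_derivative (\<lambda>v. - (2 * \<beta> * ((z - c) \<bullet> v)) / s)) (at z)"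
    using pos by (auto intro!: derivative_eq_intros simp: inner_commute field_simps)
  have eS: "exp ((\<theta> z - \<beta> * ((z - c) \<bullet> (z - c))) / s) = S z"
    using pos S0[of z] by (simp add: \<theta>_def)
  have hs: "((\<lambda>w. h i w / s) has_derivative (\<lambda>v. (J i z \<bullet> v) / s)) (at z)" for i
    using bounded_linear.has_derivative[OF bounded_linear_divide der] .
  have Kder: "(K has_derivative D) (at z)"
    using has_derivative_diff[OF has_derivative_exp[OF soft]
        has_derivative_sum[where I = UNIV, OF has_derivative_exp[OF hs]]]
    unfolding K_def D_def H_def eS by (simp add: mult.commute)
  \<comment> \<open>The gradient of \<open>s * ln (K w)\<close> at \<open>z\<close>; the factors
    \<open>s\<close> cancel.\<close>
  define \<xi> where "\<xi> = - ((S z / K z) *\<^sub>R ((2 * \<beta>) *\<^sub>R (z - c)))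
      - (\<Sum>i\<in>UNIV. (exp (h i z / s) / K z) *\<^sub>R J i z)"
  have K0: "K z > 0" by (simp add: Kz)
  have "((\<lambda>w. s * ln (K w)) has_derivative (\<lambda>v. s * (D v / K z))) (at z)"
    using K0 by (auto intro!: derivative_eq_intros Kder simp: field_simps)
  also have "(\<lambda>v. s * (D v / K z)) = (\<lambda>v. \<xi> \<bullet> v)"
    using pos K0 by (auto simp: D_def \<xi>_def inner_diff_left inner_sum_left fun_eq_iff
        sum_divide_distrib sum_distrib_left diff_divide_distrib right_diff_distrib)
  finally have lder: "((\<lambda>w. s * ln (K w)) has_derivative (\<lambda>v. \<xi> \<bullet> v)) (at z)" .
  have "isCont K z" using Kder by (rule has_derivative_continuous)
  then have "(K \<longlongrightarrow> K z) (nhds z)" by (simp add: isCont_def tendsto_nhds_iff)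
  \<comment> \<open>Positivity near \<open>z\<close> is what allows taking the logarithm of
    \<open>K w \<le> exp (p w / s)\<close>.\<close>
  then have "\<forall>\<^sub>F w in nhds z. K w > 0" using K0 by (rule order_tendstoD)
  moreover have "\<forall>\<^sub>F w in nhds z. w \<in> ball c r"
    using zr by (intro eventually_nhds_in_open) auto
  ultimately have "\<forall>\<^sub>F w in nhds z. ereal (s * ln (K w)) \<le> \<psi> w"
  proof eventually_elim
    case (elim w)
    then have w: "w \<in> cball c r" by auto
    have "(\<theta> z - \<beta> * ((w - c) \<bullet> (w - c))) / s \<le> ln (S w)"
      using min[OF w] pos by (simp add: \<theta>_def field_simps)
    then have "exp ((\<theta> z - \<beta> * ((w - c) \<bullet> (w - c))) / s) \<le> S w"
      using S0 by (simp add: ln_ge_iff)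
    then have "K w \<le> exp (p w / s)" by (simp add: K_def S_def)
    then have "ln (K w) \<le> p w / s" using elim by (simp add: ln_le_cancel_iff[symmetric])
    then show ?case using fin[OF w] pos by (simp add: field_simps)
  qed
  moreover have "\<psi> z = ereal (s * ln (K z))" using fin[OF z] pos by (simp add: Kz)
  ultimately have sub: "\<xi> \<in> regular_subdiff \<psi> z"
    using lder by (intro smooth_lower_support_regular_subdiff) auto

  \<comment> \<open>The soft maximum weights. Since \<open>lam = K z / S z\<close>, multiplying
    \<open>\<xi>\<close> by \<open>lam\<close> removes the denominators \<open>K z\<close> and
    leaves the stationarity equation.\<close>
  define lam where "lam = exp (p z / s) / S z"
  define \<mu> where "\<mu> = (\<chi> i. exp (h i z / s) / S z)"
  show thesis
  proof (rule that[OF zr])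
    show "\<beta> * (norm (z - c))\<^sup>2 \<le> a + s * ln (1 + CARD('i))" using zB by (simp add: B_def)
    show "lam \<le> exp (p z / s)" using S1 by (simp add: lam_def divide_le_eq)
    show "\<mu> $ i \<le> exp (h i z / s)" for i using S1 by (simp add: \<mu>_def divide_le_eq)
    show "lam + (\<Sum>i\<in>UNIV. \<mu> $ i) = 1"
      using S0[of z] by (simp add: lam_def \<mu>_def sum_divide_distrib[symmetric]
          add_divide_distrib[symmetric] S_def H_def)
    show "\<xi> \<in> regular_subdiff \<psi> z" by (fact sub)
    have "lam *\<^sub>R \<xi> = - ((2 * \<beta>) *\<^sub>R (z - c)) - (\<Sum>i\<in>UNIV. \<mu> $ i *\<^sub>R J i z)"
      using S0[of z] by (simp add: lam_def \<mu>_def \<xi>_def Kz scaleR_diff_right scaleR_sum_right)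
    then show "lam *\<^sub>R \<xi> + (\<Sum>i\<in>UNIV. \<mu> $ i *\<^sub>R J i z) + (2 * \<beta>) *\<^sub>R (z - c) = 0" by simp
  qed (use S0[of z] in \<open>auto simp: lam_def \<mu>_def\<close>)
qed

section \<open>Passage to the limit along the direction\<close>

text \<open>With smoothing parameter \<open>(t k)\<^sup>2\<close>, a decrease linear in
  \<open>t k\<close> gives an exponent of at most \<open>- (c / t k)\<close>, and
  \<open>x \<le> exp x\<close> bounds the exponential by \<open>t k / c\<close>.\<close>

lemma exp_scaled_tendsto_0:
  fixes q t :: "'b \<Rightarrow> real"
  assumes "c > 0" "\<forall>\<^sub>F k in F. q k \<le> - (c * t k)" "\<forall>\<^sub>F k in F. t k > 0" "(t \<longlongrightarrow> 0) F"
  shows "((\<lambda>k. exp (q k / (t k)\<^sup>2)) \<longlongrightarrow> 0) F"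
proof (rule Lim_null_comparison)
  show "\<forall>\<^sub>F k in F. norm (exp (q k / (t k)\<^sup>2)) \<le> t k / c"
    using assms(2,3)
  proof eventually_elim
    case (elim k)
    have "q k / (t k)\<^sup>2 \<le> - (c * t k) / (t k)\<^sup>2" using elim by (intro divide_right_mono) auto
    also have "\<dots> = - (c / t k)" using elim by (simp add: power2_eq_square)
    finally have "exp (q k / (t k)\<^sup>2) \<le> inverse (exp (c / t k))" by (simp add: exp_minus[symmetric])
    also have "c / t k \<le> exp (c / t k)" using exp_ge_add_one_self[of "c / t k"] by linarith
    then have "inverse (exp (c / t k)) \<le> inverse (c / t k)"
      using elim assms(1) by (intro le_imp_inverse_le) auto
    finally show ?case by simp
  qed
  show "((\<lambda>k. t k / c) \<longlongrightarrow> 0) F" using tendsto_divide[OF assms(4) tendsto_const, of c] assms(1) by simp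
qed

text \<open>The soft maximum lemma is applied around \<open>z0 + t *\<^sub>R d\<close> with
  parameters tending to 0. Weights summing to 1 and Lipschitz-bounded subgradients give a convergent
  subsequence; exponential decay of the weights gives the complementarity relations.\<close>

lemma directional_multipliers:
  fixes \<psi> :: "'a::euclidean_space \<Rightarrow> ereal" and h :: "'i::finite \<Rightarrow> 'a \<Rightarrow> real"
  assumes fin: "\<And>w. w \<in> S \<Longrightarrow> \<psi> w = ereal (p w)"
    and lip: "\<And>w w'. w \<in> S \<Longrightarrow> w' \<in> S \<Longrightarrow> \<bar>p w - p w'\<bar> \<le> L * norm (w - w')" and L: "0 \<le> L"
    and z0: "z0 \<in> S" and \<rho>: "\<rho> > 0" and \<tau>: "\<tau> > 0"
    and cone: "\<And>t w. 0 < t \<Longrightarrow> t < \<tau> \<Longrightarrow> norm (w - (z0 + t *\<^sub>R d)) \<le> \<rho> * t \<Longrightarrow> w \<in> S"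
    and der: "\<And>i z. (h i has_derivative (\<lambda>w. J i z \<bullet> w)) (at z)"
    and contJ: "\<And>i. isCont (J i) z0"
    and nonneg: "\<And>z. z \<in> S \<Longrightarrow> 0 \<le> p z \<or> (\<exists>i. 0 \<le> h i z)"
    and p0: "p z0 = 0" and pl: "((\<lambda>t. p (z0 + t *\<^sub>R d) / t) \<longlongrightarrow> l) (at_right 0)" and l: "l \<le> 0"
    and h0: "\<And>i. h i z0 \<le> 0" and hd: "\<And>i. h i z0 = 0 \<Longrightarrow> J i z0 \<bullet> d \<le> 0"
  obtains lam \<xi> and \<mu> :: "real ^ 'i"
  where "0 \<le> lam" "\<And>i. 0 \<le> \<mu> $ i" "lam + (\<Sum>i\<in>UNIV. \<mu> $ i) = 1"
    "lam * l = 0" "\<And>i. \<mu> $ i * h i z0 = 0" "\<And>i. \<mu> $ i * (J i z0 \<bullet> d) = 0"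
    "\<xi> \<in> dir_limiting_subdiff \<psi> z0 d"
    "lam *\<^sub>R \<xi> + (\<Sum>i\<in>UNIV. \<mu> $ i *\<^sub>R J i z0) = 0"
proof -
  \<comment> \<open>A single \<open>\<kappa>\<close> controls the step length, the error in the
    direction and the residual of the stationarity equation.\<close>
  have step: "\<exists>t e lam (\<mu> :: real ^ 'i) \<xi>. 0 < t \<and> t < \<kappa> \<and> norm (e - d) \<le> \<kappa> \<and>
      z0 + t *\<^sub>R d \<in> S \<and> z0 + t *\<^sub>R e \<in> S \<and>
      0 \<le> lam \<and> lam \<le> exp (p (z0 + t *\<^sub>R e) / t\<^sup>2) \<and>
      (\<forall>i. 0 \<le> \<mu> $ i \<and> \<mu> $ i \<le> exp (h i (z0 + t *\<^sub>R e) / t\<^sup>2)) \<and>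
      lam + (\<Sum>i\<in>UNIV. \<mu> $ i) = 1 \<and> \<xi> \<in> regular_subdiff \<psi> (z0 + t *\<^sub>R e) \<and> norm \<xi> \<le> L \<and>
      norm (lam *\<^sub>R \<xi> + (\<Sum>i\<in>UNIV. \<mu> $ i *\<^sub>R J i (z0 + t *\<^sub>R e))) \<le> 2 * \<kappa>\<^sup>2"
    if \<kappa>: "0 < \<kappa>" "\<kappa> < \<rho>" for \<kappa>
  proof -
    \<comment> \<open>The budget for the objective at the centre is \<open>\<kappa> ^ 3 * t\<close>:
      one half for the functions themselves, the other for the smoothing excess
      \<open>t\<^sup>2 * N\<close>. With penalty coefficient \<open>\<kappa> / t\<close> it places
      the minimiser within \<open>\<kappa> * t\<close> of the centre.\<close>
    define C where "C = \<kappa> ^ 3 / 2"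
    define N where "N = ln (1 + real CARD('i))"
    have "C > 0" using \<kappa> by (simp add: C_def)
    have hev: "\<forall>\<^sub>F t in at_right 0. h i (z0 + t *\<^sub>R d) \<le> C * t" for i
    proof (cases "h i z0 = 0")
      case True
      have "((\<lambda>t. (h i (z0 + t *\<^sub>R d) - h i z0) / t) \<longlongrightarrow> J i z0 \<bullet> d) (at_right 0)"
        by (rule has_derivative_tendsto_difference_quotient[OF der])
          (auto simp: eventually_at_right_less tendsto_ident_at)
      moreover have "J i z0 \<bullet> d < C" using hd[OF True] \<open>C > 0\<close> by simp
      ultimately have "\<forall>\<^sub>F t in at_right 0. (h i (z0 + t *\<^sub>R d) - h i z0) / t < C"
        by (rule order_tendstoD)
      then show ?thesis using eventually_at_right_less[of "0::real"]
        by eventually_elim (simp add: True field_simps)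
    next
      case False
      with h0[of i] have "h i z0 < 0" by simp
      have "isCont (h i) z0" using der by (rule has_derivative_continuous)
      moreover have "((\<lambda>t. z0 + t *\<^sub>R d) \<longlongrightarrow> z0) (at_right 0)"
        by (auto intro!: tendsto_eq_intros)
      ultimately have "((\<lambda>t. h i (z0 + t *\<^sub>R d)) \<longlongrightarrow> h i z0) (at_right 0)"
        by (rule isCont_tendsto_compose)
      then have "\<forall>\<^sub>F t in at_right 0. h i (z0 + t *\<^sub>R d) < 0"
        using \<open>h i z0 < 0\<close> by (rule order_tendstoD)
      then show ?thesis using eventually_at_right_less[of "0::real"]
      proof eventually_elim
        case (elim t)
        then have "0 < C * t" using \<open>C > 0\<close> by simp
        with elim show ?case by linarith
      qed
    qed
    have "\<forall>\<^sub>F t in at_right 0. p (z0 + t *\<^sub>R d) / t < C"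
      using order_tendstoD(2)[OF pl, of C] l \<open>C > 0\<close> by simp
    moreover have "((\<lambda>t. t * N) \<longlongrightarrow> 0) (at_right 0)" by (auto intro!: tendsto_eq_intros)
    then have "\<forall>\<^sub>F t in at_right 0. t * N < C" using \<open>C > 0\<close> by (rule order_tendstoD)
    moreover have "\<forall>\<^sub>F t in at_right 0. t < \<kappa>" "\<forall>\<^sub>F t in at_right 0. t < \<tau>"
      using \<kappa> \<tau> by (auto intro!: order_tendstoD(2)[OF tendsto_ident_at])
    moreover have "\<forall>\<^sub>F t in at_right 0. \<forall>i. h i (z0 + t *\<^sub>R d) \<le> C * t"
      using hev by (intro eventually_all_finite) auto
    ultimately have "\<forall>\<^sub>F t in at_right 0. 0 < t \<and> p (z0 + t *\<^sub>R d) \<le> C * t \<and> t * N < C \<and>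
        t < \<kappa> \<and> t < \<tau> \<and> (\<forall>i. h i (z0 + t *\<^sub>R d) \<le> C * t)"
      using eventually_at_right_less[of "0::real"]
      by eventually_elim (simp add: field_simps)
    then obtain t where t: "0 < t" "p (z0 + t *\<^sub>R d) \<le> C * t" "t * N < C" "t < \<kappa>" "t < \<tau>"
      "\<And>i. h i (z0 + t *\<^sub>R d) \<le> C * t"
      using eventually_happens'[OF trivial_limit_at_right_real] by blast
    define c where "c = z0 + t *\<^sub>R d"
    have cS: "w \<in> S" if "w \<in> cball c (\<rho> * t)" for w
      using that by (intro cone[OF t(1,5)]) (simp add: c_def dist_norm norm_minus_commute)
    have B: "C * t + t\<^sup>2 * ln (1 + CARD('i)) \<le> \<kappa> ^ 3 * t"
    proof -
      have "t * (t * N) \<le> t * C" using t by (intro mult_left_mono) auto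
      then show ?thesis by (simp add: C_def N_def power2_eq_square field_simps)
    qed
    have cont: "continuous_on (cball c (\<rho> * t)) p"
      by (rule continuous_on_subset[OF lipschitz_on_continuous_on[where X = S and L = L]])
        (use lip cS L in \<open>auto simp: lipschitz_on_def dist_norm dist_real_def\<close>)
    \<comment> \<open>The right-hand side is \<open>\<kappa> * \<rho>\<^sup>2 * t\<close>, so
      \<open>\<kappa> < \<rho>\<close> makes it exceed the budget.\<close>
    have small: "C * t + t\<^sup>2 * ln (1 + CARD('i)) < \<kappa> / t * (\<rho> * t)\<^sup>2"
    proof -
      have "\<kappa>\<^sup>2 < \<rho>\<^sup>2" using \<kappa> by (intro power_strict_mono) auto
      then have "\<kappa> * t * \<kappa>\<^sup>2 < \<kappa> * t * \<rho>\<^sup>2" using \<kappa> t by (intro mult_strict_left_mono) auto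
      then have "\<kappa> ^ 3 * t < \<kappa> / t * (\<rho> * t)\<^sup>2"
        using t by (simp add: power2_eq_square power3_eq_cube mult_ac)
      with B show ?thesis by linarith
    qed
    have finc: "\<psi> w = ereal (p w)" and nonnegc: "0 \<le> p w \<or> (\<exists>i. 0 \<le> h i w)"
      if "w \<in> cball c (\<rho> * t)" for w
      using fin[OF cS[OF that]] nonneg[OF cS[OF that]] by auto
    have nn: "0 < \<rho> * t" "0 < t\<^sup>2" "0 < \<kappa> / t" using t \<kappa> \<rho> by auto
    obtain z lam and \<mu> :: "real ^ 'i" and \<xi> where
      z: "z \<in> ball c (\<rho> * t)" "\<kappa> / t * (norm (z - c))\<^sup>2 \<le> C * t + t\<^sup>2 * ln (1 + CARD('i))" and
      lam: "0 \<le> lam" "lam \<le> exp (p z / t\<^sup>2)" and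
      \<mu>: "\<And>i. 0 \<le> \<mu> $ i" "\<And>i. \<mu> $ i \<le> exp (h i z / t\<^sup>2)" and
      lm: "lam + (\<Sum>i\<in>UNIV. \<mu> $ i) = 1" and \<xi>: "\<xi> \<in> regular_subdiff \<psi> z" and
      eq: "lam *\<^sub>R \<xi> + (\<Sum>i\<in>UNIV. \<mu> $ i *\<^sub>R J i z) + (2 * (\<kappa> / t)) *\<^sub>R (z - c) = 0"
      by (rule penalized_soft_max_multipliers[OF nn finc cont der nonnegc
            t(2)[folded c_def] t(6)[folded c_def] small]) (assumption, assumption, rule that)
    \<comment> \<open>The minimiser is rewritten as \<open>z0 + t *\<^sub>R e\<close>, so that
      \<open>e\<close> is the perturbed direction required by the directional
      subdifferential.\<close>
    define e where "e = (1 / t) *\<^sub>R (z - z0)"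
    have ze: "z = z0 + t *\<^sub>R e" using t by (simp add: e_def)
    have "(norm (z - c))\<^sup>2 \<le> (\<kappa> * t)\<^sup>2"
    proof -
      have "\<kappa> * (norm (z - c))\<^sup>2 \<le> \<kappa> * (\<kappa> * t)\<^sup>2"
        using order_trans[OF z(2) B] t
        by (simp add: power2_eq_square power3_eq_cube field_simps)
      then show ?thesis using \<kappa> by simp
    qed
    then have zc: "norm (z - c) \<le> \<kappa> * t"
      by (rule power2_le_imp_le) (use \<kappa> t in simp)
    have "z - c = t *\<^sub>R (e - d)" by (simp add: ze c_def algebra_simps)
    with zc t have ed: "norm (e - d) \<le> \<kappa>" by (simp add: mult.commute)
    have zS: "z \<in> S" using z cS by auto
    have near: "\<forall>\<^sub>F w in nhds z. w \<in> ball c (\<rho> * t)"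
      using z by (intro eventually_nhds_in_open) auto
    have "norm \<xi> \<le> L"
    proof (rule regular_subdiff_norm_le_lipschitz[OF \<xi> _ _ L])
      show "\<forall>\<^sub>F w in nhds z. \<psi> w = ereal (p w)"
        using near by eventually_elim (use fin cS in auto)
      show "\<forall>\<^sub>F w in nhds z. \<bar>p w - p z\<bar> \<le> L * norm (w - z)"
        using near by eventually_elim (use lip cS zS in auto)
    qed
    \<comment> \<open>By stationarity this vector is minus the penalty gradient, whose norm is
      \<open>2 * (\<kappa> / t) * norm (z - c)\<close>.\<close>
    moreover have "norm (lam *\<^sub>R \<xi> + (\<Sum>i\<in>UNIV. \<mu> $ i *\<^sub>R J i z)) \<le> 2 * \<kappa>\<^sup>2"
    proof -
      have "norm (lam *\<^sub>R \<xi> + (\<Sum>i\<in>UNIV. \<mu> $ i *\<^sub>R J i z)) = 2 * (\<kappa> / t) * norm (z - c)"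
        using eq t \<kappa> by (simp add: eq_neg_iff_add_eq_0[symmetric])
      also have "\<dots> \<le> 2 * (\<kappa> / t) * (\<kappa> * t)" using zc t \<kappa> by (intro mult_left_mono) auto
      finally show ?thesis using t by (simp add: power2_eq_square)
    qed
    moreover have "c \<in> S" using cS \<rho> t by simp
    ultimately show ?thesis
      using t(1,4) ed lam \<mu> lm \<xi> zS unfolding ze c_def
      by (intro exI[of _ t] exI[of _ e] exI[of _ lam] exI[of _ \<mu>] exI[of _ \<xi>] conjI allI)
  qed

  define \<kappa> where "\<kappa> n = min (\<rho> / 2) (inverse (real (Suc n)))" for n
  have \<kappa>: "0 < \<kappa> n" "\<kappa> n < \<rho>" for n using \<rho> by (auto simp: \<kappa>_def min_def)
  have \<kappa>0: "\<kappa> \<longlonglongrightarrow> 0"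
    unfolding \<kappa>_def using tendsto_min[OF tendsto_const LIMSEQ_inverse_real_of_nat, of "\<rho> / 2"] \<rho>
    by simp
  have "\<forall>n. \<exists>t e lam (\<mu> :: real ^ 'i) \<xi>. 0 < t \<and> t < \<kappa> n \<and> norm (e - d) \<le> \<kappa> n \<and>
      z0 + t *\<^sub>R d \<in> S \<and> z0 + t *\<^sub>R e \<in> S \<and>
      0 \<le> lam \<and> lam \<le> exp (p (z0 + t *\<^sub>R e) / t\<^sup>2) \<and>
      (\<forall>i. 0 \<le> \<mu> $ i \<and> \<mu> $ i \<le> exp (h i (z0 + t *\<^sub>R e) / t\<^sup>2)) \<and>
      lam + (\<Sum>i\<in>UNIV. \<mu> $ i) = 1 \<and> \<xi> \<in> regular_subdiff \<psi> (z0 + t *\<^sub>R e) \<and> norm \<xi> \<le> L \<and>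
      norm (lam *\<^sub>R \<xi> + (\<Sum>i\<in>UNIV. \<mu> $ i *\<^sub>R J i (z0 + t *\<^sub>R e))) \<le> 2 * (\<kappa> n)\<^sup>2"
    by (intro allI step \<kappa>)
  from this[unfolded choice_iff] obtain t e lam \<xi> and \<mu> :: "nat \<Rightarrow> real ^ 'i" where
    all: "\<forall>n. 0 < t n \<and> t n < \<kappa> n \<and> norm (e n - d) \<le> \<kappa> n \<and>
      z0 + t n *\<^sub>R d \<in> S \<and> z0 + t n *\<^sub>R e n \<in> S \<and>
      0 \<le> lam n \<and> lam n \<le> exp (p (z0 + t n *\<^sub>R e n) / (t n)\<^sup>2) \<and>
      (\<forall>i. 0 \<le> \<mu> n $ i \<and> \<mu> n $ i \<le> exp (h i (z0 + t n *\<^sub>R e n) / (t n)\<^sup>2)) \<and>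
      lam n + (\<Sum>i\<in>UNIV. \<mu> n $ i) = 1 \<and> \<xi> n \<in> regular_subdiff \<psi> (z0 + t n *\<^sub>R e n) \<and>
      norm (\<xi> n) \<le> L \<and>
      norm (lam n *\<^sub>R \<xi> n + (\<Sum>i\<in>UNIV. \<mu> n $ i *\<^sub>R J i (z0 + t n *\<^sub>R e n))) \<le> 2 * (\<kappa> n)\<^sup>2"
    by (elim exE) (rule that)
  have seq: "0 < t n" "t n < \<kappa> n" "norm (e n - d) \<le> \<kappa> n"
      "z0 + t n *\<^sub>R d \<in> S" "z0 + t n *\<^sub>R e n \<in> S" "0 \<le> lam n"
      "lam n \<le> exp (p (z0 + t n *\<^sub>R e n) / (t n)\<^sup>2)" "0 \<le> \<mu> n $ i"
      "\<mu> n $ i \<le> exp (h i (z0 + t n *\<^sub>R e n) / (t n)\<^sup>2)"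
      "lam n + (\<Sum>i\<in>UNIV. \<mu> n $ i) = 1"
      "\<xi> n \<in> regular_subdiff \<psi> (z0 + t n *\<^sub>R e n)" "norm (\<xi> n) \<le> L"
      "norm (lam n *\<^sub>R \<xi> n + (\<Sum>i\<in>UNIV. \<mu> n $ i *\<^sub>R J i (z0 + t n *\<^sub>R e n))) \<le> 2 * (\<kappa> n)\<^sup>2" for n i
    using spec[OF all, of n] by simp_all
  define z where "z n = z0 + t n *\<^sub>R e n" for n
  have t0: "t \<longlonglongrightarrow> 0"
    by (rule tendsto_sandwich[OF _ _ tendsto_const \<kappa>0])
      (auto intro!: always_eventually less_imp_le[OF seq(1)] less_imp_le[OF seq(2)])
  have ed: "e \<longlonglongrightarrow> d"
    by (rule LIM_zero_cancel, rule Lim_null_comparison[OF _ \<kappa>0]) (simp add: seq)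
  have zz0: "z \<longlonglongrightarrow> z0"
    unfolding z_def using tendsto_add[OF tendsto_const tendsto_scaleR[OF t0 ed]] by simp
  have tpos: "\<forall>\<^sub>F n in sequentially. t n > 0" using seq by simp
  \<comment> \<open>A weight dies out as soon as the difference quotient of its function has a
    negative limit \<open>b\<close>, since then eventually
    \<open>q n \<le> (b / 2) * t n\<close>.\<close>
  have decay: "a \<longlonglongrightarrow> 0"
    if "\<And>n. 0 \<le> a n" "\<And>n. a n \<le> exp (q n / (t n)\<^sup>2)"
      and ql: "(\<lambda>n. q n / t n) \<longlonglongrightarrow> b" "b < 0" for a q b
  proof (rule tendsto_sandwich[OF _ _ tendsto_const])
    have "\<forall>\<^sub>F n in sequentially. q n / t n < b / 2" using that by (intro order_tendstoD) auto
    then have "\<forall>\<^sub>F n in sequentially. q n \<le> - ((- b / 2) * t n)"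
      using tpos by eventually_elim (simp add: field_simps)
    then show "(\<lambda>n. exp (q n / (t n)\<^sup>2)) \<longlonglongrightarrow> 0"
      using tpos t0 \<open>b < 0\<close> by (intro exp_scaled_tendsto_0[where c = "- b / 2"]) auto
  qed (use that in auto)
  \<comment> \<open>The limit \<open>l\<close> is known only along \<open>d\<close> itself; the
    Lipschitz estimate transfers it to the directions \<open>e n\<close>, with quotient error at
    most \<open>L * norm (e n - d)\<close>.\<close>
  have lam0: "lam \<longlonglongrightarrow> 0" if "l < 0"
  proof (rule decay[OF seq(6,7) _ that])
    have "filterlim t (at_right 0) sequentially"
      using t0 tpos by (intro filterlim_at_withinI) auto
    from filterlim_compose[OF pl this]
    have 1: "(\<lambda>n. p (z0 + t n *\<^sub>R d) / t n) \<longlonglongrightarrow> l" .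
    have "(\<lambda>n. L * norm (e n - d)) \<longlonglongrightarrow> 0"
      using tendsto_mult[OF tendsto_const tendsto_norm[OF LIM_zero[OF ed]]] by simp
    then have "(\<lambda>n. p (z0 + t n *\<^sub>R e n) / t n - p (z0 + t n *\<^sub>R d) / t n) \<longlonglongrightarrow> 0"
    proof (rule Lim_null_comparison[rotated])
      have "\<bar>p (z0 + t n *\<^sub>R e n) / t n - p (z0 + t n *\<^sub>R d) / t n\<bar> \<le> L * norm (e n - d)" for n
      proof -
        have "\<bar>p (z0 + t n *\<^sub>R e n) - p (z0 + t n *\<^sub>R d)\<bar> \<le> L * norm (t n *\<^sub>R (e n - d))"
          using lip[OF seq(5) seq(4), of n n] by (simp add: algebra_simps)
        then show ?thesis using seq(1)[of n]
          by (simp add: diff_divide_distrib[symmetric] pos_divide_le_eq mult_ac)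
      qed
      then show "\<forall>\<^sub>F n in sequentially.
          norm (p (z0 + t n *\<^sub>R e n) / t n - p (z0 + t n *\<^sub>R d) / t n) \<le> L * norm (e n - d)" by simp
    qed
    from tendsto_add[OF this 1] show "(\<lambda>n. p (z0 + t n *\<^sub>R e n) / t n) \<longlonglongrightarrow> l" by simp
  qed
  have \<mu>0: "(\<lambda>n. \<mu> n $ i) \<longlonglongrightarrow> 0" if "h i z0 < 0 \<or> J i z0 \<bullet> d < 0" for i
  proof (cases "h i z0 = 0")
    case True
    have "(\<lambda>n. (h i (z0 + t n *\<^sub>R e n) - h i z0) / t n) \<longlonglongrightarrow> J i z0 \<bullet> d"
      by (rule has_derivative_tendsto_difference_quotient[OF der t0 tpos ed])
    with True that show ?thesis by (intro decay[OF seq(8,9)]) auto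
  next
    \<comment> \<open>For an inactive constraint the value stays below \<open>h i z0 / 2\<close>; as
      \<open>t n < 1\<close>, this constant bound also gives a linear one.\<close>
    case False
    then have neg: "h i z0 < 0" using h0[of i] by simp
    have "(\<lambda>n. h i (z n)) \<longlonglongrightarrow> h i z0"
      by (rule isCont_tendsto_compose[OF has_derivative_continuous[OF der] zz0])
    then have "\<forall>\<^sub>F n in sequentially. h i (z n) < h i z0 / 2" using neg by (intro order_tendstoD) auto
    moreover have "\<forall>\<^sub>F n in sequentially. t n < 1" using t0 by (rule order_tendstoD) simp
    ultimately have "\<forall>\<^sub>F n in sequentially. h i (z n) \<le> - ((- h i z0 / 2) * t n)"
    proof eventually_elim
      case (elim n)
      have "h i z0 / 2 * 1 \<le> h i z0 / 2 * t n"
        using elim neg by (intro mult_left_mono_neg) auto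
      with elim show ?case by simp
    qed
    then have "(\<lambda>n. exp (h i (z n) / (t n)\<^sup>2)) \<longlonglongrightarrow> 0"
      using neg tpos t0 by (intro exp_scaled_tendsto_0[where c = "- h i z0 / 2"]) auto
    then show ?thesis
      by (rule Lim_null_comparison[rotated]) (simp add: z_def seq)
  qed

  have lam1: "lam n \<le> 1" and \<mu>1: "(\<Sum>i\<in>UNIV. \<mu> n $ i) \<le> 1" for n
    using seq(6)[of n] seq(10)[of n] sum_nonneg[of UNIV "\<lambda>i. \<mu> n $ i"] seq(8)[of n] by auto
  have "norm (lam n, \<mu> n, \<xi> n) \<le> 1 + (1 + L)" for n
  proof -
    have "norm (\<mu> n) \<le> 1" using norm_le_l1_cart[of "\<mu> n"] \<mu>1[of n] seq(8) by simp
    then show ?thesis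
      using norm_Pair_le[of "lam n" "(\<mu> n, \<xi> n)"] norm_Pair_le[of "\<mu> n" "\<xi> n"]
        seq(6,12)[of n] lam1[of n] by simp
  qed
  then have "bounded (range (\<lambda>n. (lam n, \<mu> n, \<xi> n)))" by (auto simp: bounded_iff)
  then obtain lim r where r: "strict_mono (r :: nat \<Rightarrow> nat)"
    and lim: "((\<lambda>n. (lam n, \<mu> n, \<xi> n)) \<circ> r) \<longlonglongrightarrow> lim"
    using bounded_imp_convergent_subsequence by blast
  obtain la m x where lim_eq: "lim = (la, m, x)" by (cases lim)
  have la: "(\<lambda>n. lam (r n)) \<longlonglongrightarrow> la" and m: "(\<lambda>n. \<mu> (r n)) \<longlonglongrightarrow> m" and x: "(\<lambda>n. \<xi> (r n)) \<longlonglongrightarrow> x"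
    using tendsto_fst[OF lim] tendsto_fst[OF tendsto_snd[OF lim]] tendsto_snd[OF tendsto_snd[OF lim]]
    by (auto simp: lim_eq o_def)
  have mi: "(\<lambda>n. \<mu> (r n) $ i) \<longlonglongrightarrow> m $ i" for i using m by (rule tendsto_vec_nth)
  have sub: "(\<lambda>n. s (r n)) \<longlonglongrightarrow> b" if "s \<longlonglongrightarrow> b" for s :: "nat \<Rightarrow> 'z::topological_space" and b
    using LIMSEQ_subseq_LIMSEQ[OF that r] by (simp add: o_def)
  have m0: "m $ i = 0" if "h i z0 < 0 \<or> J i z0 \<bullet> d < 0" for i
    using LIMSEQ_unique[OF mi sub[OF \<mu>0[OF that]]] .
  show thesis
  proof (rule that[of la m x])
    show "0 \<le> la" using la by (rule LIMSEQ_le_const) (auto simp: seq)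
    show "0 \<le> m $ i" for i using mi by (rule LIMSEQ_le_const) (auto simp: seq)
    \<comment> \<open>The normalisation survives the limit and is what makes the multiplier
      nonzero.\<close>
    have "(\<lambda>n. lam (r n) + (\<Sum>i\<in>UNIV. \<mu> (r n) $ i)) \<longlonglongrightarrow> la + (\<Sum>i\<in>UNIV. m $ i)"
      by (intro tendsto_intros la mi)
    then show "la + (\<Sum>i\<in>UNIV. m $ i) = 1" by (simp add: seq LIMSEQ_const_iff)
    show "la * l = 0"
      using LIMSEQ_unique[OF la sub[OF lam0]] l by (cases "l = 0") auto
    show "m $ i * h i z0 = 0" for i using m0[of i] h0[of i] by fastforce
    show "m $ i * (J i z0 \<bullet> d) = 0" for i
      using m0[of i] h0[of i] hd[of i] by (cases "h i z0 = 0"; cases "J i z0 \<bullet> d = 0") auto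
    have "(\<lambda>n. lam (r n) *\<^sub>R \<xi> (r n) + (\<Sum>i\<in>UNIV. \<mu> (r n) $ i *\<^sub>R J i (z (r n))))
        \<longlonglongrightarrow> la *\<^sub>R x + (\<Sum>i\<in>UNIV. m $ i *\<^sub>R J i z0)"
      by (intro tendsto_intros la mi x isCont_tendsto_compose[OF contJ] sub[OF zz0])
    moreover have "(\<lambda>n. lam (r n) *\<^sub>R \<xi> (r n) + (\<Sum>i\<in>UNIV. \<mu> (r n) $ i *\<^sub>R J i (z (r n)))) \<longlonglongrightarrow> 0"
    proof (rule Lim_null_comparison)
      show "(\<lambda>n. 2 * (\<kappa> (r n))\<^sup>2) \<longlonglongrightarrow> 0"
        using sub[OF \<kappa>0] by (auto intro!: tendsto_eq_intros)
    qed (simp add: z_def seq)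
    ultimately show "la *\<^sub>R x + (\<Sum>i\<in>UNIV. m $ i *\<^sub>R J i z0) = 0" by (rule LIMSEQ_unique)
    \<comment> \<open>Convergence of the function values is part of the definition of the limiting
      subdifferential; here it follows from the Lipschitz estimate, as \<open>z0\<close> lies in
      \<open>S\<close>.\<close>
    have "(\<lambda>n. p (z (r n))) \<longlonglongrightarrow> p z0"
    proof (rule LIM_zero_cancel, rule Lim_null_comparison)
      show "(\<lambda>n. L * norm (z (r n) - z0)) \<longlonglongrightarrow> 0"
        using tendsto_mult[OF tendsto_const tendsto_norm[OF LIM_zero[OF sub[OF zz0]]]] by simp
      show "\<forall>\<^sub>F n in sequentially. norm (p (z (r n)) - p z0) \<le> L * norm (z (r n) - z0)"
        using lip[OF seq(5) z0] by (simp add: z_def)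
    qed
    then have "(\<lambda>n. \<psi> (z0 + t (r n) *\<^sub>R e (r n))) \<longlonglongrightarrow> \<psi> z0"
      using fin[OF seq(5)] fin[OF z0] by (simp add: z_def)
    then show "x \<in> dir_limiting_subdiff \<psi> z0 d"
      unfolding dir_limiting_subdiff_def using fin[OF z0] seq(1,11) sub[OF t0] sub[OF ed] x
      by (intro CollectI conjI exI[of _ "\<lambda>n. t (r n)"] exI[of _ "\<lambda>n. e (r n)"]
          exI[of _ "\<lambda>n. \<xi> (r n)"]) auto
  qed
qed

section \<open>Scalarisation, gradients of components, and sign of \<open>f - V\<close>\<close>

text \<open>The points and directions approximating \<open>\<xi>\<close> are kept; continuity of
  \<open>J\<close> makes the perturbed regular subgradients converge.\<close>

lemma dir_limiting_subdiff_scale_add_smooth: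
  fixes \<psi> :: "'a::real_inner \<Rightarrow> ereal"
  assumes "\<xi> \<in> dir_limiting_subdiff \<psi> z d" and "0 \<le> c"
    and der: "\<And>w. (h has_derivative (\<lambda>v. J w \<bullet> v)) (at w)" and cont: "isCont J z"
  shows "c *\<^sub>R \<xi> + J z \<in> dir_limiting_subdiff (\<lambda>w. ereal c * \<psi> w + ereal (h w)) z d"
proof -
  from assms(1) obtain t dk \<xi>k where fin: "\<bar>\<psi> z\<bar> \<noteq> \<infinity>" and t: "\<And>k. t k > 0" "t \<longlonglongrightarrow> 0"
    and dk: "dk \<longlonglongrightarrow> d" and \<xi>k: "\<xi>k \<longlonglongrightarrow> \<xi>"
    and val: "(\<lambda>k. \<psi> (z + t k *\<^sub>R dk k)) \<longlonglongrightarrow> \<psi> z"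
    and reg: "\<And>k. \<xi>k k \<in> regular_subdiff \<psi> (z + t k *\<^sub>R dk k)"
    unfolding dir_limiting_subdiff_def mem_Collect_eq by (elim conjE exE) (rule that, auto)
  have zk: "(\<lambda>k. z + t k *\<^sub>R dk k) \<longlonglongrightarrow> z"
    using tendsto_add[OF tendsto_const tendsto_scaleR[OF t(2) dk]] by simp
  have "(\<lambda>k. c *\<^sub>R \<xi>k k + J (z + t k *\<^sub>R dk k)) \<longlonglongrightarrow> c *\<^sub>R \<xi> + J z"
    by (intro tendsto_intros \<xi>k isCont_tendsto_compose[OF cont zk])
  moreover have "(\<lambda>k. ereal c * \<psi> (z + t k *\<^sub>R dk k) + ereal (h (z + t k *\<^sub>R dk k)))
      \<longlonglongrightarrow> ereal c * \<psi> z + ereal (h z)"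
    using fin isCont_tendsto_compose[OF has_derivative_continuous[OF der] zk]
    by (intro tendsto_add_ereal tendsto_cmult_ereal val) auto
  moreover have "c *\<^sub>R \<xi>k k + J (z + t k *\<^sub>R dk k)
      \<in> regular_subdiff (\<lambda>w. ereal c * \<psi> w + ereal (h w)) (z + t k *\<^sub>R dk k)" for k
    by (rule regular_subdiff_scale_add_smooth[OF reg assms(2) der])
  moreover have "\<bar>ereal c * \<psi> z + ereal (h z)\<bar> \<noteq> \<infinity>" using fin by auto
  ultimately show ?thesis
    unfolding dir_limiting_subdiff_def mem_Collect_eq using t dk
    by (intro conjI exI[of _ t] exI[of _ dk] exI[of _ "\<lambda>k. c *\<^sub>R \<xi>k k + J (z + t k *\<^sub>R dk k)"]) auto
qed

text \<open>Row \<open>i\<close> of the Jacobian as a vector of the domain. Through the adjoint, the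
  transposed Jacobian applied to \<open>\<mu>\<close> becomes a weighted sum of these rows.\<close>

definition component_gradient :: "('a::euclidean_space \<Rightarrow> real ^ 'k) \<Rightarrow> 'k \<Rightarrow> 'a \<Rightarrow> 'a" where
  "component_gradient g i z = adjoint (frechet_derivative g (at z)) (axis i 1)"

lemma component_gradient:
  fixes g :: "'a::euclidean_space \<Rightarrow> real ^ 'k"
  assumes "continuously_differentiable g"
  shows component_gradient_inner:
      "component_gradient g i z \<bullet> w = frechet_derivative g (at z) w $ i"
    and component_gradient_has_derivative:
      "((\<lambda>z. g z $ i) has_derivative (\<lambda>w. component_gradient g i z \<bullet> w)) (at z)"
    and isCont_component_gradient: "isCont (component_gradient g i) z"
    and adjoint_frechet_derivative_eq_sum:
      "adjoint (frechet_derivative g (at z)) \<mu> = (\<Sum>i\<in>UNIV. \<mu> $ i *\<^sub>R component_gradient g i z)"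
proof -
  obtain g' where der: "\<And>z. (g has_derivative blinfun_apply (g' z)) (at z)"
    and cont: "continuous_on UNIV g'"
    using assms unfolding continuously_differentiable_def by blast
  have D: "frechet_derivative g (at z) = blinfun_apply (g' z)" for z
    using frechet_derivative_at[OF der] by simp
  have lin: "linear (frechet_derivative g (at z))" for z
    by (simp add: D blinfun.bounded_linear_right bounded_linear.linear)
  have inner: "component_gradient g i z \<bullet> w = frechet_derivative g (at z) w $ i" for z w
    using adjoint_works[OF lin, of w z "axis i 1"]
    by (simp add: component_gradient_def inner_axis inner_commute[of "adjoint _ _" w])
  show "component_gradient g i z \<bullet> w = frechet_derivative g (at z) w $ i" by (rule inner)
  show "((\<lambda>z. g z $ i) has_derivative (\<lambda>w. component_gradient g i z \<bullet> w)) (at z)"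
    using bounded_linear.has_derivative[OF bounded_linear_vec_nth der] by (simp add: inner D)
  \<comment> \<open>Expansion in the basis reduces continuity of the gradient to that of finitely
    many entries of \<open>g'\<close>.\<close>
  have "component_gradient g i z = (\<Sum>b\<in>Basis. (blinfun_apply (g' z) b $ i) *\<^sub>R b)" for z
    using euclidean_representation[of "component_gradient g i z"] by (simp add: inner D)
  then have eq: "component_gradient g i = (\<lambda>z. \<Sum>b\<in>Basis. (blinfun_apply (g' z) b $ i) *\<^sub>R b)"
    by blast
  have "isCont g' z" using cont by (simp add: continuous_on_eq_continuous_at)
  then have "isCont (\<lambda>z. blinfun_apply (g' z) b $ i) z" for b
    by (intro bounded_linear.isCont[OF bounded_linear_vec_nth]
        bounded_linear.isCont[OF blinfun.bounded_linear_left])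
  then show "isCont (component_gradient g i) z"
    unfolding eq by (intro continuous_sum continuous_scaleR continuous_const)
  have "\<mu> = (\<Sum>i\<in>UNIV. \<mu> $ i *\<^sub>R axis i 1)"
    using basis_expansion[of \<mu>] by (simp add: scalar_mult_eq_scaleR)
  then have "adjoint (frechet_derivative g (at z)) \<mu>
      = adjoint (frechet_derivative g (at z)) (\<Sum>i\<in>UNIV. \<mu> $ i *\<^sub>R axis i 1)" by simp
  also have "\<dots> = (\<Sum>i\<in>UNIV. \<mu> $ i *\<^sub>R component_gradient g i z)"
    using adjoint_linear[OF lin, of z]
    by (simp add: linear_sum linear_scale component_gradient_def)
  finally show "adjoint (frechet_derivative g (at z)) \<mu>
    = (\<Sum>i\<in>UNIV. \<mu> $ i *\<^sub>R component_gradient g i z)" .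
qed

lemma sum_UNIV_sum_type:
  fixes F :: "'a::finite + 'b::finite \<Rightarrow> 'c::comm_monoid_add"
  shows "(\<Sum>k\<in>UNIV. F k) = (\<Sum>a\<in>UNIV. F (Inl a)) + (\<Sum>b\<in>UNIV. F (Inr b))"
  using sum.Plus[of "UNIV :: 'a set" "UNIV :: 'b set" F] by simp

lemma dir_deriv_ereal:
  fixes f :: "'a::real_normed_vector \<Rightarrow> real"
  assumes "(f has_derivative f') (at z)"
  shows "dir_deriv (\<lambda>w. ereal (f w)) z d = ereal (f' d)"
  unfolding dir_deriv_def
proof (rule tendsto_Lim)
  have "((\<lambda>t. (f (z + t *\<^sub>R d) - f z) / t) \<longlongrightarrow> f' d) (at_right 0)"
    by (rule has_derivative_tendsto_difference_quotient[OF assms])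
      (auto simp: eventually_at_right_less tendsto_ident_at)
  then have "((\<lambda>t. ereal ((f (z + t *\<^sub>R d) - f z) / t)) \<longlongrightarrow> ereal (f' d)) (at_right 0)" by simp
  moreover have "\<forall>\<^sub>F t in at_right 0. ereal ((f (z + t *\<^sub>R d) - f z) / t)
      = (ereal (f (z + t *\<^sub>R d)) - ereal (f z)) / ereal t"
    using eventually_at_right_less[of "0::real"] by eventually_elim simp
  ultimately show "((\<lambda>t. (ereal (f (z + t *\<^sub>R d)) - ereal (f z)) / ereal t) \<longlongrightarrow> ereal (f' d))
      (at_right 0)" by (rule Lim_transform_eventually)
qed simp

text \<open>If \<open>g (a, b) \<le> 0\<close>, then \<open>b\<close> competes in the infimum that
  defines the value function at \<open>a\<close>.\<close>

lemma f_minus_V_nonneg: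
  assumes "g z \<le> 0" and "\<bar>f_minus_V f g z\<bar> \<noteq> \<infinity>"
  shows "0 \<le> f_minus_V f g z"
proof -
  obtain a b where z: "z = (a, b)" by fastforce
  have "value_fun f g a \<le> ereal (f z)"
    unfolding value_fun_def z by (rule INF_lower) (use assms z in simp)
  then show ?thesis using assms(2) z
    by (cases "value_fun f g a") (auto simp: f_minus_V_def)
qed

section \<open>The multiplier rule for (VP) and the failure of FOSCMS\<close>

theorem proposition5p1:
  fixes F f :: "(real ^ 'n) \<times> (real ^ 'm) \<Rightarrow> real"
    and g :: "(real ^ 'n) \<times> (real ^ 'm) \<Rightarrow> real ^ 'p"
    and G :: "(real ^ 'n) \<times> (real ^ 'm) \<Rightarrow> real ^ 'q"
    and x u :: "real ^ 'n" and y v :: "real ^ 'm"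
  assumes "continuously_differentiable F" "continuously_differentiable f"
    and "continuously_differentiable g" "continuously_differentiable G"
    and feasible: "VP_feasible f g G (x, y)"
    and dir_diff: "\<And>d. dir_differentiable (value_fun f g) x d"
    and critical: "(u, v) \<in> VP_critical_cone F f g G (x, y)"
    and dir_lip: "dir_lipschitz (VP_map f g G) (x, y) (u, v)"
  shows "(\<exists>(lam :: real) (\<mu> :: real ^ 'p) (\<nu> :: real ^ 'q).
           (lam, \<mu>, \<nu>) \<noteq> 0 \<and> lam \<ge> 0 \<and>
           0 \<le> \<mu> \<and> \<mu> \<bullet> g (x, y) = 0 \<and> \<mu> \<bullet> frechet_derivative g (at (x, y)) (u, v) = 0 \<and>
           0 \<le> \<nu> \<and> \<nu> \<bullet> G (x, y) = 0 \<and> \<nu> \<bullet> frechet_derivative G (at (x, y)) (u, v) = 0 \<and>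
           0 \<in> {lam *\<^sub>R \<xi> + adjoint (frechet_derivative g (at (x, y))) \<mu>
                          + adjoint (frechet_derivative G (at (x, y))) \<nu> | \<xi>.
                 \<xi> \<in> dir_limiting_subdiff (f_minus_V f g) (x, y) (u, v)}) \<and>
         \<not> FOSCMS (VP_map f g G) (x, y) (u, v)"
proof -
  define \<psi> where "\<psi> = f_minus_V f g"
  \<comment> \<open>Only the values on the set \<open>S\<close> below matter, where
    \<open>\<psi>\<close> is finite; \<open>real_of_ereal\<close> sends infinite values to
    0.\<close>
  define p where "p z = real_of_ereal (\<psi> z)" for z
  \<comment> \<open>Merging \<open>g\<close> and \<open>G\<close> over a sum type lets
    \<open>directional_multipliers\<close> treat all smooth constraints as one family.\<close>
  define h where "h k z = (case k of Inl i \<Rightarrow> g z $ i | Inr j \<Rightarrow> G z $ j)" for k :: "'p + 'q" and z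
  define J where "J k z = (case k of Inl i \<Rightarrow> component_gradient g i z
      | Inr j \<Rightarrow> component_gradient G j z)" for k :: "'p + 'q" and z
  let ?z = "(x, y)" and ?d = "(u, v)"
  note gdiff = assms(3) and Gdiff = assms(4)
  have map_simps: "VP_map f g G z $ Inl () = \<psi> z" "VP_map f g G z $ Inr k = ereal (h k z)" for z k
    by (auto simp: VP_map_def \<psi>_def h_def split: sum.split)

  obtain L \<epsilon> \<delta> where pos: "L > 0" "\<epsilon> > 0" "\<delta> > 0"
    and fin0: "\<forall>w \<in> dir_nbhd \<epsilon> \<delta> ?d. \<forall>i. \<bar>VP_map f g G (?z + w) $ i\<bar> \<noteq> \<infinity>"
    and lip0: "\<forall>w \<in> dir_nbhd \<epsilon> \<delta> ?d. \<forall>w' \<in> dir_nbhd \<epsilon> \<delta> ?d.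
      norm (real_vec (VP_map f g G (?z + w)) - real_vec (VP_map f g G (?z + w'))) \<le> L * norm (w - w')"
    using dir_lip unfolding dir_lipschitz_def by (elim exE conjE) (rule that)
  define S where "S = (+) ?z ` dir_nbhd \<epsilon> \<delta> ?d"
  have fin: "\<psi> z = ereal (p z)" if zS: "z \<in> S" for z
  proof -
    obtain w where w: "w \<in> dir_nbhd \<epsilon> \<delta> ?d" "z = ?z + w" using zS unfolding S_def by blast
    have "\<bar>VP_map f g G z $ Inl ()\<bar> \<noteq> \<infinity>" unfolding w(2) by (rule spec[OF bspec[OF fin0 w(1)]])
    then show ?thesis by (simp add: map_simps p_def ereal_real)
  qed
  have lip: "\<bar>p w - p w'\<bar> \<le> L * norm (w - w')" if wS: "w \<in> S" "w' \<in> S" for w w'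
  proof -
    obtain a b where ab: "a \<in> dir_nbhd \<epsilon> \<delta> ?d" "b \<in> dir_nbhd \<epsilon> \<delta> ?d" "w = ?z + a" "w' = ?z + b"
      using wS unfolding S_def by blast
    have "\<bar>p w - p w'\<bar> = \<bar>(real_vec (VP_map f g G w) - real_vec (VP_map f g G w')) $ Inl ()\<bar>"
      by (simp add: real_vec_def map_simps p_def)
    also have "\<dots> \<le> norm (real_vec (VP_map f g G w) - real_vec (VP_map f g G w'))"
      by (rule component_le_norm_cart)
    also have "\<dots> \<le> L * norm (w - w')" using bspec[OF bspec[OF lip0 ab(1)] ab(2)] by (simp only: ab add_diff_cancel_left)
    finally show ?thesis .
  qed
  have "0 \<in> dir_nbhd \<epsilon> \<delta> ?d" using pos by (simp add: dir_nbhd_def)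
  then have zS: "?z \<in> S" unfolding S_def by (intro image_eqI[of _ _ 0]) simp_all
  obtain \<rho> \<tau> where \<rho>: "\<rho> > 0" and \<tau>: "\<tau> > 0" and cone0:
    "\<And>t w. 0 < t \<Longrightarrow> t < \<tau> \<Longrightarrow> norm (w - t *\<^sub>R ?d) \<le> \<rho> * t \<Longrightarrow> w \<in> dir_nbhd \<epsilon> \<delta> ?d"
    using dir_nbhd_contains_cone[OF pos(2,3)] by blast
  have cone: "w \<in> S" if "0 < t" "t < \<tau>" "norm (w - (?z + t *\<^sub>R ?d)) \<le> \<rho> * t" for t w
  proof -
    have "w - ?z \<in> dir_nbhd \<epsilon> \<delta> ?d" using that by (intro cone0) (simp_all add: diff_diff_eq)
    then show ?thesis unfolding S_def by (intro image_eqI[of _ _ "w - ?z"]) simp_all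
  qed
  have der: "(h k has_derivative (\<lambda>w. J k z \<bullet> w)) (at z)" for k z
    unfolding h_def J_def
    by (cases k) (simp_all add: component_gradient_has_derivative gdiff Gdiff)
  have contJ: "isCont (J k) z" for k z
    unfolding J_def by (cases k) (simp_all add: isCont_component_gradient gdiff Gdiff)
  \<comment> \<open>Either \<open>g z \<le> 0\<close>, and then \<open>f \<ge> V\<close> at
    \<open>z\<close>, or some component of \<open>g\<close> is positive there.\<close>
  have nonneg: "0 \<le> p z \<or> (\<exists>k. 0 \<le> h k z)" if "z \<in> S" for z
  proof (cases "g z \<le> 0")
    case True
    then have "0 \<le> \<psi> z" using fin[OF that] unfolding \<psi>_def by (intro f_minus_V_nonneg) auto
    then show ?thesis using fin[OF that] by simp
  next
    case False
    then obtain i where "\<not> g z $ i \<le> 0" by (auto simp: less_eq_vec_def)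
    then have "0 \<le> h (Inl i) z" by (simp add: h_def)
    then show ?thesis by blast
  qed
  have feas: "\<psi> ?z \<le> 0" "g ?z \<le> 0" "G ?z \<le> 0"
    using feasible by (auto simp: VP_feasible_def \<psi>_def)
  have p0: "p ?z = 0"
  proof -
    have "0 \<le> \<psi> ?z" using fin[OF zS] feas unfolding \<psi>_def by (intro f_minus_V_nonneg) auto
    with feas have "\<psi> ?z = 0" by simp
    then show ?thesis by (simp add: p_def)
  qed
  have h0: "h k ?z \<le> 0" for k
    using feas by (cases k) (auto simp: h_def less_eq_vec_def)
  have Jd: "J k ?z \<bullet> w = (case k of Inl i \<Rightarrow> frechet_derivative g (at ?z) w $ i
      | Inr j \<Rightarrow> frechet_derivative G (at ?z) w $ j)" for k w
    by (cases k) (simp_all add: J_def component_gradient_inner gdiff Gdiff)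
  have hd: "J k ?z \<bullet> ?d \<le> 0" if "h k ?z = 0" for k
    using critical that unfolding Jd VP_critical_cone_def by (cases k) (auto simp: h_def)

  obtain l0 where l0: "((\<lambda>t. (value_fun f g (x + t *\<^sub>R u) - value_fun f g x) / ereal t)
      \<longlongrightarrow> ereal l0) (at_right 0)" and Vfin: "\<bar>value_fun f g x\<bar> \<noteq> \<infinity>"
    using dir_diff[of u] unfolding dir_differentiable_def by (elim conjE exE) (rule that)
  \<comment> \<open>The directional derivative of \<open>f - V\<close>; criticality says exactly
    that it is nonpositive.\<close>
  define l where "l = frechet_derivative f (at ?z) ?d - l0"
  have fder: "(f has_derivative frechet_derivative f (at ?z)) (at ?z)"
  proof -
    obtain f' where "(f has_derivative f') (at ?z)"
      using assms(2) unfolding continuously_differentiable_def by blast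
    then show ?thesis using frechet_derivative_at by blast
  qed
  have l: "l \<le> 0"
  proof -
    have "dir_deriv (value_fun f g) x u = ereal l0"
      unfolding dir_deriv_def by (rule tendsto_Lim[OF _ l0]) simp
    then show ?thesis using critical unfolding VP_critical_cone_def l_def by simp
  qed
  have inS: "\<forall>\<^sub>F t in at_right 0. ?z + t *\<^sub>R ?d \<in> S"
  proof -
    have "\<forall>\<^sub>F t in at_right 0. t < \<tau>" using \<tau> by (intro order_tendstoD(2)[OF tendsto_ident_at])
    then show ?thesis using eventually_at_right_less[of "0::real"]
      by eventually_elim (rule cone, use \<rho> in auto)
  qed
  have pl: "((\<lambda>t. p (?z + t *\<^sub>R ?d) / t) \<longlongrightarrow> l) (at_right 0)"
  proof -
    have "((\<lambda>t. (f (?z + t *\<^sub>R ?d) - f ?z) / t) \<longlongrightarrow> frechet_derivative f (at ?z) ?d) (at_right 0)"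
      by (rule has_derivative_tendsto_difference_quotient[OF fder])
        (auto simp: eventually_at_right_less tendsto_ident_at)
    then have "((\<lambda>t. ereal ((f (?z + t *\<^sub>R ?d) - f ?z) / t))
        \<longlongrightarrow> ereal (frechet_derivative f (at ?z) ?d)) (at_right 0)" by simp
    from tendsto_diff_ereal[OF _ _ this l0]
    have 1: "((\<lambda>t. ereal ((f (?z + t *\<^sub>R ?d) - f ?z) / t)
        - (value_fun f g (x + t *\<^sub>R u) - value_fun f g x) / ereal t) \<longlongrightarrow> ereal l) (at_right 0)"
      by (simp add: l_def)
    have "\<forall>\<^sub>F t in at_right 0. ereal ((f (?z + t *\<^sub>R ?d) - f ?z) / t)
        - (value_fun f g (x + t *\<^sub>R u) - value_fun f g x) / ereal t
        = ereal (p (?z + t *\<^sub>R ?d) / t)"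
      using inS eventually_at_right_less[of "0::real"]
    proof eventually_elim
      case (elim t)
      have "ereal (f ?z) - value_fun f g x = 0" using fin[OF zS] p0 by (simp add: \<psi>_def f_minus_V_def)
      \<comment> \<open>A feasible point of (VP) attains the lower level value, so both difference
        quotients start from the same number and their difference is that of
        \<open>f - V\<close>.\<close>
      then have Vx: "value_fun f g x = ereal (f ?z)" using Vfin by (cases "value_fun f g x") auto
      show ?case
        using fin[OF elim(1)] elim(2) Vx
        by (cases "value_fun f g (x + t *\<^sub>R u)")
          (auto simp: \<psi>_def f_minus_V_def diff_divide_distrib[symmetric])
    qed
    from Lim_transform_eventually[OF 1 this] show ?thesis by simp
  qed
  obtain lam \<xi> and m :: "real ^ ('p + 'q)" where
    lam: "0 \<le> lam" and m: "\<And>k. 0 \<le> m $ k" and sum1: "lam + (\<Sum>k\<in>UNIV. m $ k) = 1"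
    and laml: "lam * l = 0" and mh: "\<And>k. m $ k * h k ?z = 0" and mJ: "\<And>k. m $ k * (J k ?z \<bullet> ?d) = 0"
    and \<xi>: "\<xi> \<in> dir_limiting_subdiff \<psi> ?z ?d"
    and eq: "lam *\<^sub>R \<xi> + (\<Sum>k\<in>UNIV. m $ k *\<^sub>R J k ?z) = 0"
    by (rule directional_multipliers[OF fin lip less_imp_le[OF pos(1)] zS \<rho> \<tau> cone der contJ nonneg
        p0 pl l h0 hd]) (assumption+, rule that)

  have "\<exists>(lam :: real) (\<mu> :: real ^ 'p) (\<nu> :: real ^ 'q).
           (lam, \<mu>, \<nu>) \<noteq> 0 \<and> lam \<ge> 0 \<and>
           0 \<le> \<mu> \<and> \<mu> \<bullet> g (x, y) = 0 \<and> \<mu> \<bullet> frechet_derivative g (at (x, y)) (u, v) = 0 \<and>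
           0 \<le> \<nu> \<and> \<nu> \<bullet> G (x, y) = 0 \<and> \<nu> \<bullet> frechet_derivative G (at (x, y)) (u, v) = 0 \<and>
           0 \<in> {lam *\<^sub>R \<xi> + adjoint (frechet_derivative g (at (x, y))) \<mu>
                          + adjoint (frechet_derivative G (at (x, y))) \<nu> | \<xi>.
                 \<xi> \<in> dir_limiting_subdiff (f_minus_V f g) (x, y) (u, v)}"
  proof (intro exI conjI)
    let ?\<mu> = "\<chi> i. m $ Inl i" and ?\<nu> = "\<chi> j. m $ Inr j"
    show "(lam, ?\<mu>, ?\<nu>) \<noteq> 0"
    proof
      assume "(lam, ?\<mu>, ?\<nu>) = 0"
      then have "lam = 0" "\<And>i. m $ Inl i = 0" "\<And>j. m $ Inr j = 0"
        by (simp_all add: zero_prod_def vec_eq_iff)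
      with sum1 show False by (simp add: sum_UNIV_sum_type)
    qed
    show "?\<mu> \<bullet> g ?z = 0" "?\<nu> \<bullet> G ?z = 0"
      using mh[of "Inl _"] mh[of "Inr _"] by (auto simp: inner_vec_def h_def intro!: sum.neutral)
    show "?\<mu> \<bullet> frechet_derivative g (at ?z) ?d = 0" "?\<nu> \<bullet> frechet_derivative G (at ?z) ?d = 0"
      using mJ[of "Inl _"] mJ[of "Inr _"] by (auto simp: inner_vec_def Jd intro!: sum.neutral)
    have "lam *\<^sub>R \<xi> + adjoint (frechet_derivative g (at ?z)) ?\<mu>
        + adjoint (frechet_derivative G (at ?z)) ?\<nu> = 0"
      using eq by (simp add: adjoint_frechet_derivative_eq_sum gdiff Gdiff sum_UNIV_sum_type J_def
          add.assoc)
    then show "0 \<in> {lam *\<^sub>R \<xi> + adjoint (frechet_derivative g (at (x, y))) ?\<mu>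
        + adjoint (frechet_derivative G (at (x, y))) ?\<nu> | \<xi>.
          \<xi> \<in> dir_limiting_subdiff (f_minus_V f g) (x, y) (u, v)}"
      using \<xi> unfolding \<psi>_def mem_Collect_eq by (intro exI[of _ \<xi>] conjI) simp_all
  qed (use lam m in \<open>simp_all add: less_eq_vec_def\<close>)
  moreover have "\<not> FOSCMS (VP_map f g G) ?z ?d"
  proof -
    \<comment> \<open>The same multipliers reassembled in the component order of
      \<open>VP_map\<close>, with \<open>lam\<close> in the slot of \<open>f - V\<close>.\<close>
    define \<zeta> :: "real ^ (unit + 'p + 'q)" where
      "\<zeta> = (\<chi> k. case k of Inl _ \<Rightarrow> lam | Inr k \<Rightarrow> m $ k)"
    have \<zeta>_simps: "\<zeta> $ Inl a = lam" "\<zeta> $ Inr k = m $ k" for a k by (simp_all add: \<zeta>_def)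
    note sums = sum_UNIV_sum_type[where 'a = unit and 'b = "'p + 'q"] UNIV_unit
    have "\<zeta> \<noteq> 0"
    proof
      assume "\<zeta> = 0"
      then have "lam = 0" "\<And>k. m $ k = 0" using \<zeta>_simps by simp_all
      with sum1 show False by simp
    qed
    moreover have "0 \<le> \<zeta>" using lam m by (auto simp: less_eq_vec_def \<zeta>_def split: sum.split)
    moreover have "\<zeta> \<bullet> real_vec (VP_map f g G ?z) = 0"
      by (simp add: inner_vec_def sums \<zeta>_simps real_vec_def map_simps mh fin[OF zS] p0)
    moreover have "\<zeta> \<bullet> real_vec (\<chi> k. dir_deriv (\<lambda>w. VP_map f g G w $ k) ?z ?d) = 0"
    proof -
      have "((\<lambda>t. (\<psi> (?z + t *\<^sub>R ?d) - \<psi> ?z) / ereal t) \<longlongrightarrow> ereal l) (at_right 0)"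
      proof (rule Lim_transform_eventually)
        show "((\<lambda>t. ereal (p (?z + t *\<^sub>R ?d) / t)) \<longlongrightarrow> ereal l) (at_right 0)" using pl by simp
        show "\<forall>\<^sub>F t in at_right 0. ereal (p (?z + t *\<^sub>R ?d) / t)
            = (\<psi> (?z + t *\<^sub>R ?d) - \<psi> ?z) / ereal t"
          using inS eventually_at_right_less[of "0::real"]
          by eventually_elim (simp only: fin[OF zS] fin p0, simp)
      qed
      then have "dir_deriv \<psi> ?z ?d = ereal l"
        unfolding dir_deriv_def by (intro tendsto_Lim) auto
      then show ?thesis
        by (simp add: inner_vec_def sums \<zeta>_simps real_vec_def map_simps dir_deriv_ereal[OF der] mJ laml)
    qed
    moreover have "0 \<in> dir_limiting_subdiff (\<lambda>w. \<Sum>k\<in>UNIV. ereal (\<zeta> $ k) * VP_map f g G w $ k) ?z ?d"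
    proof -
      \<comment> \<open>The scalarised map is \<open>lam\<close> times \<open>f - V\<close> plus
        this smooth function, so the multiplier equation turns into \<open>0\<close> being a
        limiting subgradient of it.\<close>
      have sumder: "((\<lambda>w. \<Sum>k\<in>UNIV. m $ k * h k w) has_derivative
          (\<lambda>v. (\<Sum>k\<in>UNIV. m $ k *\<^sub>R J k w) \<bullet> v)) (at w)" for w
        by (auto intro!: derivative_eq_intros der simp: inner_sum_left)
      have "isCont (\<lambda>w. \<Sum>k\<in>UNIV. m $ k *\<^sub>R J k w) ?z" by (intro continuous_intros contJ)
      from dir_limiting_subdiff_scale_add_smooth[OF \<xi> lam sumder this] eq
      have "0 \<in> dir_limiting_subdiff (\<lambda>w. ereal lam * \<psi> w + ereal (\<Sum>k\<in>UNIV. m $ k * h k w)) ?z ?d"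
        by simp
      then show ?thesis by (simp add: sums \<zeta>_simps map_simps)
    qed
    ultimately show ?thesis unfolding FOSCMS_def by blast
  qed
  ultimately show ?thesis by (rule conjI)
qed

end
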